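(* Assume that the set $\mathcal{U}$ of admissible controls is nonempty. Let $\bigl(u^*(\cdot),\{x^*(\cdot;\alpha):\alpha\in\mathcal{A}\}\bigr)$ be an optimal process for the $L^1$ robust optimal control problem $\inf_{u\in\mathcal{U}}\int_0^T|u(t)|\,dt$, and let $(\eta,\Lambda,\{p(\cdot;\alpha)\})$ be associated multipliers satisfying the robust maximum principle conditions (a)--(e) listed in the context, with averaged switching function $\varphi(t)=\int_{\mathcal{A}}p(t;\alpha)^\top b(\alpha)\,\Lambda(d\alpha)$. Define the active set $\mathcal{A}^{\rm act}=\{\alpha\in\mathcal{A}:\psi(x^*(T;\alpha))=0\}$ and $\Lambda^{\rm act}=\Lambda|_{\mathcal{A}^{\rm act}}$. Suppose that: (i) (Normality) $\eta>0$. (ii) (Average controllability-like condition) For every measurable map $\alpha\mapsto v(\alpha)\in\mathbb{R}^d$ with $v(\alpha)\in N_C(x^*(T;\alpha))$ that is not $\Lambda^{\rm act}$-a.e. zero, there exists $m\in\{1,\ldots,d-1\}$ such that $$\int_{\mathcal{A}^{\rm act}}\langle A(\alpha)^m b(\alpha),v(\alpha)\rangle\,\Lambda^{\rm act}(d\alpha)\neq 0.$$ Then the optimal control admits a bang-off-bang representation: for a.e. $t\in[0,T]$, $$u^*(t)=\begin{cases}1&\text{if }\varphi(t)>\eta,\\ 0&\text{if }|\varphi(t)|<\eta,\\ -1&\text{if }\varphi(t)<-\eta\end{cases}$$ (for a.e. $t\in[0,T]$ exactly one of these three cases occurs).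
   Context: Setting. Let $d,\nu\in\mathbb{N}$ and $T>0$ be fixed. $\mathcal{A}\subset\mathbb{R}^\nu$ is a nonempty, compact, convex set of uncertain parameters. The maps $\alpha\mapsto A(\alpha)\in\mathbb{R}^{d\times d}$ and $\alpha\mapsto b(\alpha)\in\mathbb{R}^d$ are continuously differentiable on an open neighbourhood of $\mathcal{A}$. The initial state $\bar x\in\mathbb{R}^d$ is given (the same for all $\alpha$). For $u\in L^\infty([0,T];\mathbb{R})$ and $\alpha\in\mathcal{A}$, $x_u(\cdot;\alpha)\in W^{1,1}([0,T];\mathbb{R}^d)$ is the solution of $$\dot x(t;\alpha)=A(\alpha)x(t;\alpha)+b(\alpha)u(t)\ \text{ for a.e. } t\in[0,T],\qquad x(0;\alpha)=\bar x.$$ The function $\psi:\mathbb{R}^d\to\mathbb{R}$ is continuously differentiable and convex, and the terminal set $C=\{\xi\in\mathbb{R}^d:\psi(\xi)\le 0\}$ is compact and convex. The normal cone to $C$ at $x\in C$ is $N_C(x)=\{v\in\mathbb{R}^d:\langle v,y-x\rangle\le 0\text{ for all }y\in C\}$. Admissible controls: $\mathcal{U}$ is the set of $u\in L^\infty([0,T];\mathbb{R})$ with $u(t)\in[-1,1]$ for a.e. $t\in[0,T]$ and $\psi(x_u(T;\alpha))\le 0$ for all $\alpha\in\mathcal{A}$. An optimal process is $(u^*,\{x^*(\cdot;\alpha)=x_{u^*}(\cdot;\alpha)\})$ with $u^*\in\mathcal{U}$ minimizing $\int_0^T|u(t)|dt$ over $\mathcal{U}$. Robust maximum principle conditions for $(u^*,\{x^*(\cdot;\alpha)\})$: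 $\eta\in[0,1]$ is a scalar, $\Lambda$ is a non-negative Radon measure on $\mathcal{A}$, and $p(\cdot;\alpha)\in W^{1,1}([0,T];\mathbb{R}^d)$ is defined for $\Lambda$-a.e. $\alpha\in\operatorname{supp}(\Lambda)$, with: (a) $\eta+\Lambda(\mathcal{A})=1$; (b) for $\Lambda$-a.e. $\alpha$, $-\dot p(t;\alpha)=A(\alpha)^\top p(t;\alpha)$ for a.e. $t\in[0,T]$; (c) for $\Lambda$-a.e. $\alpha$ there is $\mu(\alpha)\ge0$ with $-p(T;\alpha)=\mu(\alpha)\nabla\psi(x^*(T;\alpha))$; (d) $\operatorname{supp}(\Lambda)\subset\{\alpha\in\mathcal{A}:\psi(x^*(T;\alpha))=0\}$, and for every $\alpha\in\operatorname{supp}(\Lambda)$, $\mu(\alpha)>0$ only if $\psi(x^*(T;\alpha))=0$; (e) for a.e. $t\in[0,T]$, $u^*(t)\in\operatorname{argmax}_{v\in[-1,1]}\{\varphi(t)v-\eta|v|\}$, where $\varphi(t)=\int_{\mathcal{A}}p(t;\alpha)^\top b(\alpha)\Lambda(d\alpha)$. *)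

theory Defs
  imports "HOL-Analysis.Analysis"
begin

definition C1_on :: "'a::real_normed_vector set \<Rightarrow> ('a \<Rightarrow> 'b::real_normed_vector) \<Rightarrow> bool" where
  "C1_on S f \<longleftrightarrow> open S \<and>
     (\<exists>f' :: 'a \<Rightarrow> 'a \<Rightarrow>\<^sub>L 'b.
        (\<forall>x\<in>S. (f has_derivative blinfun_apply (f' x)) (at x)) \<and> continuous_on S f')"

definition gradient :: "('a::real_inner \<Rightarrow> real) \<Rightarrow> 'a \<Rightarrow> 'a" where
  "gradient f x = (THE g. GDERIV f x :> g)"

definition normal_cone :: "'a::real_inner set \<Rightarrow> 'a \<Rightarrow> 'a set" where
  "normal_cone C x = {v. \<forall>y\<in>C. v \<bullet> (y - x) \<le> 0}"

text \<open>The operators \<open>*\<close> and \<open>^\<close> on type \<^typ>\<open>real^'d^'d\<close> act componentwise,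
  so the power with respect to the matrix product needs a definition of its own.\<close>

definition matpow :: "real^'d^'d \<Rightarrow> nat \<Rightarrow> real^'d^'d" where
  "matpow M m = (((**) M) ^^ m) (mat 1)"

text \<open>A function in \<open>W\<^sup>1\<^sup>,\<^sup>1([0,T])\<close> is identified with its (absolutely) continuous
  representative, i.e. it is the indefinite integral of its weak derivative \<open>g \<in> L\<^sup>1([0,T])\<close>.\<close>

definition has_W11_derivative :: "(real \<Rightarrow> 'a::euclidean_space) \<Rightarrow> (real \<Rightarrow> 'a) \<Rightarrow> real \<Rightarrow> bool" where
  "has_W11_derivative x g T \<longleftrightarrow> g absolutely_integrable_on {0..T} \<and>
     (\<forall>t\<in>{0..T}. x t = x 0 + integral {0..t} g)"

definition Linfty :: "real \<Rightarrow> (real \<Rightarrow> real) set" where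
  "Linfty T = {u. u \<in> borel_measurable (lebesgue_on {0..T}) \<and>
     (\<exists>K. AE t in lebesgue_on {0..T}. \<bar>u t\<bar> \<le> K)}"

definition state_solution ::
  "real \<Rightarrow> real^'d^'d \<Rightarrow> real^'d \<Rightarrow> real^'d \<Rightarrow> (real \<Rightarrow> real) \<Rightarrow> (real \<Rightarrow> real^'d) \<Rightarrow> bool" where
  "state_solution T M c x0 u x \<longleftrightarrow> x 0 = x0 \<and>
     (\<exists>g. has_W11_derivative x g T \<and> (AE t in lebesgue_on {0..T}. g t = M *v x t + u t *\<^sub>R c))"

definition adjoint_solution :: "real \<Rightarrow> real^'d^'d \<Rightarrow> (real \<Rightarrow> real^'d) \<Rightarrow> bool" where
  "adjoint_solution T M p \<longleftrightarrow>
     (\<exists>g. has_W11_derivative p g T \<and> (AE t in lebesgue_on {0..T}. - g t = transpose M *v p t))"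

definition terminal_set :: "(real^'d \<Rightarrow> real) \<Rightarrow> (real^'d) set" where
  "terminal_set \<psi> = {\<xi>. \<psi> \<xi> \<le> 0}"

text \<open>The state equation is linear, so for \<open>u \<in> L\<^sup>\<infinity>\<close> its solution exists and is unique on
  \<open>[0,T]\<close>; the existential quantifier below just names this solution.\<close>

definition admissible_controls ::
  "real \<Rightarrow> (real^'k) set \<Rightarrow> (real^'k \<Rightarrow> real^'d^'d) \<Rightarrow> (real^'k \<Rightarrow> real^'d) \<Rightarrow> real^'d
     \<Rightarrow> (real^'d \<Rightarrow> real) \<Rightarrow> (real \<Rightarrow> real) set" where
  "admissible_controls T \<A> A b x0 \<psi> =
     {u \<in> Linfty T. (AE t in lebesgue_on {0..T}. u t \<in> {-1..1}) \<and>
        (\<forall>\<alpha>\<in>\<A>. \<exists>x. state_solution T (A \<alpha>) (b \<alpha>) x0 u x \<and> \<psi> (x T) \<le> 0)}"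

definition optimal_process ::
  "real \<Rightarrow> (real^'k) set \<Rightarrow> (real^'k \<Rightarrow> real^'d^'d) \<Rightarrow> (real^'k \<Rightarrow> real^'d) \<Rightarrow> real^'d
     \<Rightarrow> (real^'d \<Rightarrow> real) \<Rightarrow> (real \<Rightarrow> real) \<Rightarrow> (real^'k \<Rightarrow> real \<Rightarrow> real^'d) \<Rightarrow> bool" where
  "optimal_process T \<A> A b x0 \<psi> u x \<longleftrightarrow>
     u \<in> admissible_controls T \<A> A b x0 \<psi> \<and>
     (\<forall>\<alpha>\<in>\<A>. state_solution T (A \<alpha>) (b \<alpha>) x0 u (x \<alpha>)) \<and>
     (\<forall>w\<in>admissible_controls T \<A> A b x0 \<psi>.
        (LINT t|lebesgue_on {0..T}. \<bar>u t\<bar>) \<le> (LINT t|lebesgue_on {0..T}. \<bar>w t\<bar>))"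

definition radon_measure_on :: "'a::topological_space set \<Rightarrow> 'a measure \<Rightarrow> bool" where
  "radon_measure_on S M \<longleftrightarrow> sets M = sets (restrict_space borel S) \<and>
     (\<forall>K. compact K \<and> K \<subseteq> S \<longrightarrow> emeasure M K < \<infinity>) \<and>
     (\<forall>B\<in>sets M. emeasure M B = (SUP K\<in>{K. compact K \<and> K \<subseteq> B}. emeasure M K))"

definition measure_support :: "'a::topological_space measure \<Rightarrow> 'a set" where
  "measure_support M =
     {x \<in> space M. \<forall>U. open U \<and> x \<in> U \<longrightarrow> emeasure M (U \<inter> space M) > 0}"

definition switching_function ::
  "(real^'k \<Rightarrow> real^'d) \<Rightarrow> (real^'k) measure \<Rightarrow> (real^'k \<Rightarrow> real \<Rightarrow> real^'d) \<Rightarrow> real \<Rightarrow> real" where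
  "switching_function b \<Lambda> p t = (LINT \<alpha>|\<Lambda>. p \<alpha> t \<bullet> b \<alpha>)"

definition active_set ::
  "real \<Rightarrow> (real^'k) set \<Rightarrow> (real^'d \<Rightarrow> real) \<Rightarrow> (real^'k \<Rightarrow> real \<Rightarrow> real^'d) \<Rightarrow> (real^'k) set" where
  "active_set T \<A> \<psi> x = {\<alpha>\<in>\<A>. \<psi> (x \<alpha> T) = 0}"

text \<open>The values of \<open>p\<close> on a \<open>\<Lambda>\<close>-null set are irrelevant, so \<open>p\<close> is a total function of
  \<open>\<alpha>\<close>. The integrability clause says that the integral defining the switching function exists
  for every \<open>t \<in> [0,T]\<close>.\<close>

definition robust_pmp ::
  "real \<Rightarrow> (real^'k) set \<Rightarrow> (real^'k \<Rightarrow> real^'d^'d) \<Rightarrow> (real^'k \<Rightarrow> real^'d) \<Rightarrow> (real^'d \<Rightarrow> real)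
     \<Rightarrow> (real \<Rightarrow> real) \<Rightarrow> (real^'k \<Rightarrow> real \<Rightarrow> real^'d)
     \<Rightarrow> real \<Rightarrow> (real^'k) measure \<Rightarrow> (real^'k \<Rightarrow> real \<Rightarrow> real^'d) \<Rightarrow> bool" where
  "robust_pmp T \<A> A b \<psi> u x \<eta> \<Lambda> p \<longleftrightarrow>
     \<eta> \<in> {0..1} \<and> radon_measure_on \<A> \<Lambda> \<and>
     (\<forall>t\<in>{0..T}. integrable \<Lambda> (\<lambda>\<alpha>. p \<alpha> t \<bullet> b \<alpha>)) \<and>
     \<eta> + measure \<Lambda> \<A> = 1 \<and>
     (AE \<alpha> in \<Lambda>. adjoint_solution T (A \<alpha>) (p \<alpha>)) \<and>
     (\<exists>\<mu> :: real^'k \<Rightarrow> real.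
        (AE \<alpha> in \<Lambda>. \<mu> \<alpha> \<ge> 0 \<and> - p \<alpha> T = \<mu> \<alpha> *\<^sub>R gradient \<psi> (x \<alpha> T)) \<and>
        measure_support \<Lambda> \<subseteq> active_set T \<A> \<psi> x \<and>
        (\<forall>\<alpha>\<in>measure_support \<Lambda>. \<mu> \<alpha> > 0 \<longrightarrow> \<psi> (x \<alpha> T) = 0)) \<and>
     (AE t in lebesgue_on {0..T}.
        is_arg_max (\<lambda>v. switching_function b \<Lambda> p t * v - \<eta> * \<bar>v\<bar>) (\<lambda>v. v \<in> {-1..1}) (u t))"

text \<open>The test fields \<open>v\<close> are those for which the integrals in the condition exist.  Without
  that clause the convention that a divergent Bochner integral is \<open>0\<close> would turn every
  non-integrable \<open>v\<close> into a spurious additional requirement.\<close>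

definition average_controllability ::
  "real \<Rightarrow> (real^'k) set \<Rightarrow> (real^'k \<Rightarrow> real^'d^'d) \<Rightarrow> (real^'k \<Rightarrow> real^'d) \<Rightarrow> (real^'d \<Rightarrow> real)
     \<Rightarrow> (real^'k \<Rightarrow> real \<Rightarrow> real^'d) \<Rightarrow> (real^'k) measure \<Rightarrow> bool" where
  "average_controllability T \<A> A b \<psi> x \<Lambda> \<longleftrightarrow>
     (let \<Lambda>act = restrict_space \<Lambda> (active_set T \<A> \<psi> x) in
      \<forall>v :: real^'k \<Rightarrow> real^'d.
        v \<in> borel_measurable \<Lambda>act \<longrightarrow>
        (\<forall>\<alpha>\<in>active_set T \<A> \<psi> x. v \<alpha> \<in> normal_cone (terminal_set \<psi>) (x \<alpha> T)) \<longrightarrow>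
        (\<forall>m\<in>{1..CARD('d) - 1}. integrable \<Lambda>act (\<lambda>\<alpha>. (matpow (A \<alpha>) m *v b \<alpha>) \<bullet> v \<alpha>)) \<longrightarrow>
        \<not> (AE \<alpha> in \<Lambda>act. v \<alpha> = 0) \<longrightarrow>
        (\<exists>m\<in>{1..CARD('d) - 1}. (LINT \<alpha>|\<Lambda>act. (matpow (A \<alpha>) m *v b \<alpha>) \<bullet> v \<alpha>) \<noteq> 0))"

end

theory Submission
  imports Defs "HOL-Complex_Analysis.Complex_Analysis"
begin

text \<open>
  The control is forced by the maximum condition wherever \<open>\<bar>\<phi>\<bar> \<noteq> \<eta>\<close>, so the point is that
  \<open>\<phi>\<close> takes each of the values \<open>\<eta>\<close> and \<open>- \<eta>\<close> only finitely often in \<open>[0,T]\<close>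
  (\<open>switching_function_level_finite\<close>).

  For a single parameter the adjoint equation gives
  \<open>p (T - s) \<bullet> b = (\<Sum>k. a\<^sub>k s\<^sup>k / k!)\<close> with moments \<open>a\<^sub>k = p T \<bullet> A\<^sup>k b\<close>
  (\<open>adjoint_taylor_series\<close>).  If this series may be integrated over the parameters, \<open>\<phi>\<close> is the
  restriction of an entire function.  A value \<open>y \<noteq> 0\<close> taken infinitely often then makes \<open>\<phi>\<close>
  constantly \<open>y\<close>, so the mean of \<open>a\<^sub>0\<close> is \<open>y\<close> and the means of all later moments vanish
  (\<open>entire_series_constant_of_infinite_level_set\<close>).  Up to sign the moments are those of a field of
  normal vectors to the terminal set, because \<open>- p T\<close> is a nonnegative multiple of the gradient
  of \<open>\<psi>\<close>.  The controllability condition makes this field vanish almost everywhere, hence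
  \<open>a\<^sub>0 = 0\<close> almost everywhere and \<open>y = 0\<close>, a contradiction.

  The multipliers \<open>\<mu>\<close> are neither bounded nor measurable by assumption; only
  \<open>\<alpha> \<mapsto> p \<alpha> t \<bullet> b \<alpha>\<close> is known to be integrable, for each separate time \<open>t\<close>.  This costs two
  additional arguments.

  Integrability of the moments.  All \<open>a\<^sub>k\<close> are dominated by the first \<open>d\<close> of them,
  \<open>\<bar>a\<^sub>k\<bar> \<le> K\<^sup>k (\<bar>a\<^sub>0\<bar> + \<dots> + \<bar>a\<^bsub>d-1\<^esub>\<bar>)\<close>, with \<open>K\<close> depending only on a
  bound of \<open>A\<close> (\<open>krylov_moment_growth\<close>, a quantitative substitute for the Cayley-Hamilton
  theorem).  So a difference quotient at a small step, fixed for all parameters, recovers \<open>a\<^sub>i\<close>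
  up to a small multiple of this sum, which is absorbed in the end (locale
  \<open>exponential_coefficients\<close>).

  Measurability of the normal field.  The terminal state depends continuously on the parameter
  (\<open>terminal_state_continuous_on\<close>, by Gronwall's inequality), so \<open>\<mu>\<close> can be recovered as a least
  squares quotient of measurable functions wherever the moments determine it, and replaced by
  \<open>0\<close> elsewhere without changing the moments.
\<close>

section \<open>Growth of exponentially bounded linear recurrences\<close>

text \<open>
  The polynomial \<open>q\<close> in the shift operator, applied to the sequence \<open>s\<close>; it vanishes
  identically when \<open>s\<close> satisfies the linear recurrence with characteristic polynomial \<open>q\<close>.
\<close>

definition shift_poly :: "complex poly \<Rightarrow> (nat \<Rightarrow> complex) \<Rightarrow> nat \<Rightarrow> complex" where
  "shift_poly q s n = (\<Sum>i\<le>degree q. coeff q i * s (n + i))"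

lemma shift_poly_upto:
  assumes "degree q \<le> N"
  shows "shift_poly q s n = (\<Sum>i\<le>N. coeff q i * s (n + i))"
  unfolding shift_poly_def
  by (rule sum.mono_neutral_left) (use assms in \<open>auto simp: coeff_eq_0\<close>)

lemma shift_poly_linear_factor:
  "shift_poly ([:-z, 1:] * r) s n = shift_poly r s (Suc n) - z * shift_poly r s n"
proof -
  have 1: "[:-z, 1:] * r = pCons 0 r - smult z r" by simp
  have "degree ([:-z, 1:] * r) \<le> Suc (degree r)"
    by (rule order_trans[OF degree_mult_le]) simp
  then have "shift_poly ([:-z, 1:] * r) s n = (\<Sum>i\<le>Suc (degree r). coeff ([:-z, 1:] * r) i * s (n + i))"
    by (rule shift_poly_upto)
  also have "\<dots> = (\<Sum>i\<le>Suc (degree r). coeff (pCons 0 r) i * s (n + i))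
      - z * (\<Sum>i\<le>Suc (degree r). coeff r i * s (n + i))"
    unfolding 1 by (simp only: coeff_diff coeff_smult sum_subtractf[symmetric] sum_distrib_left left_diff_distrib mult.assoc)
  also have "(\<Sum>i\<le>Suc (degree r). coeff (pCons 0 r) i * s (n + i)) = shift_poly r s (Suc n)"
    by (simp only: sum.atMost_Suc_shift shift_poly_def) simp
  also have "(\<Sum>i\<le>Suc (degree r). coeff r i * s (n + i)) = shift_poly r s n"
    by (rule shift_poly_upto[symmetric]) simp
  finally show ?thesis .
qed

lemma shift_poly_difference:
  "shift_poly r (\<lambda>k. s (Suc k) - z * s k) n = shift_poly r s (Suc n) - z * shift_poly r s n"
  by (simp add: shift_poly_def sum_subtractf sum_distrib_left algebra_simps)

text \<open>
  The bound depends only on the growth rate \<open>R\<close> of the sequence and on the order of the recurrence,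
  not on the coefficients of the recurrence nor on the constant \<open>C\<close>.  The proof splits off one linear
  factor \<open>x - z\<close> of \<open>q\<close> at a time.  If \<open>\<bar>z\<bar> \<le> R\<close>, the sequence \<open>s (Suc n) - z * s n\<close> satisfies
  a recurrence of lower order, and \<open>s\<close> is regained from it by summation.  If \<open>\<bar>z\<bar> > R\<close>, the
  remaining factor already annihilates \<open>s\<close>, since otherwise it would produce a multiple of \<open>z\<^sup>n\<close>,
  which outgrows \<open>R\<^sup>n\<close>.
\<close>

lemma recurrence_growth:
  fixes s :: "nat \<Rightarrow> complex"
  assumes "\<And>n. norm (s n) \<le> C * R ^ n" and R: "R \<ge> 0"
    and "q \<noteq> 0" "degree q \<le> D" "\<And>n. shift_poly q s n = 0"
  shows "norm (s n) \<le> (2 * R + 1) ^ n * (\<Sum>j<D. norm (s j))"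
  using assms(1,3-)
proof (induction D arbitrary: q s C n)
  case 0
  then have "coeff q 0 \<noteq> 0"
    by (metis bot_nat_0.extremum_uniqueI leading_coeff_0_iff)
  with 0(3) 0(4)[of n] have "s n = 0" by (simp add: shift_poly_def)
  then show ?case by simp
next
  case (Suc D)
  define K where "K = 2 * R + 1"
  have K: "K \<ge> 0" using R by (simp add: K_def)
  have mono: "(\<Sum>j<D. norm (s j)) \<le> (\<Sum>j<Suc D. norm (s j))" for s :: "nat \<Rightarrow> complex" by simp
  have le: "norm (s n) \<le> (2 * R + 1) ^ n * (\<Sum>j<Suc D. norm (s j))"
    if "norm (s n) \<le> (2 * R + 1) ^ n * (\<Sum>j<D. norm (s j))"
    using order_trans[OF that mult_left_mono[OF mono]] R by simp
  show ?case
  proof (cases "degree q = 0")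
    case True
    then show ?thesis using Suc.IH[OF Suc.prems(1,2) _ Suc.prems(4)] le by simp
  next
    case False
    then have "\<exists>i\<in>{1..degree q}. coeff q i \<noteq> 0"
      using Suc.prems(2) by (intro bexI[of _ "degree q"]) auto
    then obtain z where "(\<Sum>i\<le>degree q. coeff q i * z ^ i) = 0"
      using fundamental_theorem_of_algebra[of "coeff q" "degree q"] by blast
    then have "poly q z = 0" by (simp add: poly_altdef)
    then obtain r where q: "q = [:-z, 1:] * r" by (auto simp: poly_eq_0_iff_dvd)
    with Suc.prems(2) have r0: "r \<noteq> 0" by auto
    have "degree q = Suc (degree r)" using r0 unfolding q
      by (subst degree_mult_eq) (auto simp del: mult_pCons_left)
    with Suc.prems(3) have degr: "degree r \<le> D" by simp
    have step: "shift_poly r s (Suc n) = z * shift_poly r s n" for n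
      using Suc.prems(4)[of n] unfolding q shift_poly_linear_factor by simp
    show ?thesis
    proof (cases "norm z \<le> R")
      case True
      \<comment> \<open>A small root: pass to a sequence of lower order and integrate back.\<close>
      define s' where "s' = (\<lambda>k. s (Suc k) - z * s k)"
      have s'R: "norm (s' k) \<le> norm (s (Suc k)) + R * norm (s k)" for k
        unfolding s'_def using norm_triangle_ineq4[of "s (Suc k)" "z * s k"]
          mult_right_mono[OF True, of "norm (s k)"] by (simp add: norm_mult)
      define N where "N = (\<Sum>j<Suc D. norm (s j))"
      have N0: "N \<ge> 0" unfolding N_def by (simp add: sum_nonneg)
      have C: "norm (s' k) \<le> (2 * R * C) * R ^ k" for k
        using s'R[of k] Suc.prems(1)[of "Suc k"] mult_left_mono[OF Suc.prems(1)[of k] R]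
        by (simp add: algebra_simps)
      have IH': "norm (s' k) \<le> K ^ k * (\<Sum>j<D. norm (s' j))" for k
        unfolding K_def
        by (rule Suc.IH[OF C r0 degr]) (simp add: s'_def shift_poly_difference step)
      have "(\<Sum>j<D. norm (s' j)) \<le> (\<Sum>j<D. norm (s (Suc j))) + R * (\<Sum>j<D. norm (s j))"
        unfolding sum_distrib_left sum.distrib[symmetric] by (intro sum_mono s'R)
      moreover have "(\<Sum>j<D. norm (s (Suc j))) \<le> N"
        unfolding N_def by (subst sum.lessThan_Suc_shift) simp
      moreover have "R * (\<Sum>j<D. norm (s j)) \<le> R * N"
        unfolding N_def by (intro mult_left_mono R mono)
      ultimately have "(\<Sum>j<D. norm (s' j)) \<le> (1 + R) * N"
        by (simp add: distrib_right)
      then have "K ^ k * (\<Sum>j<D. norm (s' j)) \<le> K ^ k * ((1 + R) * N)" for k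
        using K by (intro mult_left_mono) auto
      with IH' have s'N: "norm (s' k) \<le> K ^ k * ((1 + R) * N)" for k
        using order_trans by blast
      have "norm (s n) \<le> K ^ n * N" for n
      proof (induction n)
        case 0
        show ?case unfolding N_def by (subst sum.lessThan_Suc_shift) (simp add: sum_nonneg)
      next
        case (Suc n)
        have "s (Suc n) = s' n + z * s n" by (simp add: s'_def)
        then have "norm (s (Suc n)) \<le> norm (s' n) + norm z * norm (s n)"
          by (metis norm_mult norm_triangle_ineq)
        also have "\<dots> \<le> K ^ n * ((1 + R) * N) + R * (K ^ n * N)"
          using True Suc R by (intro add_mono s'N mult_mono) auto
        also have "\<dots> = K ^ Suc n * N" by (simp add: K_def algebra_simps)
        finally show ?case .
      qed
      then show ?thesis by (simp add: K_def N_def)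
    next
      case False
      \<comment> \<open>A large root: the geometric sequence \<open>y\<close> vanishes, so the factor is superfluous.\<close>
      define y where "y = shift_poly r s"
      have yn: "y n = z ^ n * y 0" for n
        by (induction n) (simp_all add: y_def step)
      define B where "B = (\<Sum>i\<le>degree r. norm (coeff r i) * (\<bar>C\<bar> * R ^ i))"
      have "norm (y n) \<le> B * R ^ n" for n
      proof -
        have "norm (y n) \<le> (\<Sum>i\<le>degree r. norm (coeff r i) * norm (s (n + i)))"
          unfolding y_def shift_poly_def by (rule order_trans[OF norm_sum]) (simp add: norm_mult)
        also have "\<dots> \<le> (\<Sum>i\<le>degree r. norm (coeff r i) * (\<bar>C\<bar> * R ^ (n + i)))"
        proof (intro sum_mono mult_left_mono)
          fix i show "norm (s (n + i)) \<le> \<bar>C\<bar> * R ^ (n + i)"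
            using Suc.prems(1)[of "n + i"] mult_right_mono[OF abs_ge_self[of C], of "R ^ (n+i)"] R by simp
        qed simp
        also have "\<dots> = B * R ^ n"
          unfolding B_def sum_distrib_right by (intro sum.cong) (simp_all add: power_add mult_ac)
        finally show ?thesis .
      qed
      then have bd: "norm z ^ n * norm (y 0) \<le> B * R ^ n" for n
        by (metis norm_mult norm_power yn)
      have "y 0 = 0"
      proof (rule ccontr)
        assume y0: "y 0 \<noteq> 0"
        define \<rho> where "\<rho> = R / norm z"
        have z: "norm z > 0" using False R by linarith
        have \<rho>: "0 \<le> \<rho>" "\<rho> < 1" using False R z by (auto simp: \<rho>_def)
        have "norm (y 0) \<le> B * \<rho> ^ n" for n
          using bd[of n] z by (simp add: \<rho>_def power_divide field_simps)
        moreover have "(\<lambda>n. B * \<rho> ^ n) \<longlonglongrightarrow> B * 0"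
          by (intro tendsto_intros LIMSEQ_power_zero) (use \<rho> in auto)
        ultimately have "norm (y 0) \<le> B * 0"
          by (intro LIMSEQ_le_const) auto
        then show False using y0 by simp
      qed
      then have "shift_poly r s n = 0" for n using yn[of n] by (simp add: y_def)
      then show ?thesis by (intro le Suc.IH[OF Suc.prems(1) r0 degr])
    qed
  qed
qed

section \<open>Moments of a matrix\<close>

lemma matpow_0 [simp]: "matpow M 0 = mat 1"
  and matpow_Suc: "matpow M (Suc n) = M ** matpow M n"
  by (simp_all add: matpow_def)

lemma matpow_vec_add: "matpow M (m + n) *v c = matpow M m *v (matpow M n *v c)"
  by (induction m) (simp_all add: matpow_Suc matrix_vector_mul_assoc[symmetric])

lemma norm_matpow_vec_le:
  assumes "\<And>x. norm (M *v x) \<le> R * norm x" "R \<ge> 0"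
  shows "norm (matpow M n *v c) \<le> R ^ n * norm c"
proof (induction n)
  case (Suc n)
  have "norm (matpow M (Suc n) *v c) \<le> R * norm (matpow M n *v c)"
    using assms(1) by (simp add: matpow_Suc matrix_vector_mul_assoc[symmetric])
  also have "\<dots> \<le> R * (R ^ n * norm c)" by (intro mult_left_mono Suc assms)
  finally show ?case by simp
qed simp

lemma krylov_dependence:
  fixes M :: "real^'d^'d"
  shows "\<exists>q :: real poly. q \<noteq> 0 \<and> degree q \<le> CARD('d) \<and>
    (\<Sum>i\<le>CARD('d). coeff q i *\<^sub>R (matpow M i *v c)) = 0"
proof -
  define f where "f i = matpow M i *v c" for i
  define d where "d = CARD('d)"
  have "\<exists>g :: nat \<Rightarrow> real. (\<exists>i\<le>d. g i \<noteq> 0) \<and> (\<Sum>i\<le>d. g i *\<^sub>R f i) = 0"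
  proof (cases "inj_on f {..d}")
    case True
    have "card (f ` {..d}) > DIM(real^'d)"
      using card_image[OF True] by (simp add: d_def)
    then have "dependent (f ` {..d})"
      by (intro dependent_biggerset) auto
    then obtain h where h: "\<exists>v\<in>f ` {..d}. h v \<noteq> 0" "(\<Sum>v\<in>f ` {..d}. h v *\<^sub>R v) = 0"
      by (auto simp: dependent_finite)
    show ?thesis
      by (rule exI[of _ "h \<circ> f"]) (use h True in \<open>auto simp: sum.reindex\<close>)
  next
    case False
    then obtain i j where ij: "i \<le> d" "j \<le> d" "i \<noteq> j" "f i = f j" by (auto simp: inj_on_def)
    define g where "g k = (if k = i then 1 else if k = j then -1 else 0 :: real)" for k
    have "(\<Sum>k\<le>d. g k *\<^sub>R f k) = (\<Sum>k\<in>{i,j}. g k *\<^sub>R f k)"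
      using ij by (intro sum.mono_neutral_right) (auto simp: g_def)
    also have "\<dots> = 0" using ij by (simp add: g_def)
    finally show ?thesis using ij(1) by (intro exI[of _ g]) (auto simp: g_def)
  qed
  then obtain g where g: "\<exists>i\<le>d. g i \<noteq> 0" "(\<Sum>i\<le>d. g i *\<^sub>R f i) = (0 :: real^'d)" by blast
  define q where "q = (\<Sum>i\<le>d. monom (g i) i)"
  have co: "coeff q k = (if k \<le> d then g k else 0)" for k
    by (auto simp: q_def coeff_sum)
  have "q \<noteq> 0" using g(1) co by (metis coeff_0)
  moreover have "degree q \<le> d" by (rule degree_le) (simp add: co)
  moreover have "(\<Sum>i\<le>d. coeff q i *\<^sub>R f i) = 0" using g(2) by (simp add: co)
  ultimately show ?thesis unfolding d_def f_def by blast
qed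

text \<open>
  A linear dependence among \<open>c, M c, \<dots>, M\<^sup>d c\<close> is a recurrence for the moments.  Its leading
  coefficient may be arbitrarily small, which is why the bound has to come from
  \<open>recurrence_growth\<close>, uniform in the recurrence, rather than from solving for the last term.
\<close>

lemma krylov_moment_growth:
  fixes M :: "real^'d^'d"
  assumes M: "\<And>x. norm (M *v x) \<le> R * norm x" and R: "R \<ge> 0"
  shows "\<bar>w \<bullet> (matpow M n *v c)\<bar> \<le> (2 * R + 1) ^ n * (\<Sum>j<CARD('d). \<bar>w \<bullet> (matpow M j *v c)\<bar>)"
proof -
  obtain q :: "real poly" where q: "q \<noteq> 0" "degree q \<le> CARD('d)"
    "(\<Sum>i\<le>CARD('d). coeff q i *\<^sub>R (matpow M i *v c)) = 0" using krylov_dependence by blast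
  define Q where "Q = map_poly complex_of_real q"
  have co: "coeff Q i = of_real (coeff q i)" for i by (simp add: Q_def coeff_map_poly)
  have Q: "Q \<noteq> 0" "degree Q \<le> CARD('d)"
    using q by (auto simp: Q_def map_poly_eq_0_iff degree_map_poly)
  define s where "s k = complex_of_real (w \<bullet> (matpow M k *v c))" for k
  have "norm (s k) \<le> (norm w * norm c) * R ^ k" for k
  proof -
    have "norm (s k) \<le> norm w * norm (matpow M k *v c)"
      unfolding s_def norm_of_real by (rule Cauchy_Schwarz_ineq2)
    also have "\<dots> \<le> norm w * (R ^ k * norm c)"
      by (intro mult_left_mono norm_matpow_vec_le M R) simp
    finally show ?thesis by (simp add: algebra_simps)
  qed
  moreover have "shift_poly Q s k = 0" for k
  proof -
    have "shift_poly Q s k = of_real (w \<bullet> (matpow M k *v (\<Sum>i\<le>CARD('d). coeff q i *\<^sub>R (matpow M i *v c))))"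
      unfolding shift_poly_upto[OF Q(2)] s_def co
      by (simp add: matpow_vec_add linear_sum[OF matrix_vector_mul_linear] inner_sum_right
          matrix_vector_mult_scaleR)
    then show ?thesis by (simp add: q(3))
  qed
  ultimately have "norm (s n) \<le> (2 * R + 1) ^ n * (\<Sum>j<CARD('d). norm (s j))"
    using R Q by (intro recurrence_growth) auto
  then show ?thesis by (simp add: s_def)
qed

section \<open>The adjoint equation\<close>

lemma AE_lebesgue_on_negligibleE:
  assumes "AE t in lebesgue_on S. P t" "S \<in> sets lebesgue"
  obtains N where "negligible N" "\<And>t. t \<in> S - N \<Longrightarrow> P t"
proof -
  have "AE t in lebesgue. t \<in> S \<longrightarrow> P t"
    using assms by (simp add: AE_restrict_space_iff)
  then obtain N where "N \<in> null_sets lebesgue" "{t \<in> space lebesgue. \<not> (t \<in> S \<longrightarrow> P t)} \<subseteq> N"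
    by (auto simp: eventually_ae_filter)
  then show ?thesis
    by (intro that[of N]) (auto simp: negligible_iff_null_sets)
qed

lemma W11_imp_continuous_on:
  assumes "has_W11_derivative x g T"
  shows "continuous_on {0..T} x"
proof -
  have "g integrable_on {0..T}" and x: "\<And>t. t \<in> {0..T} \<Longrightarrow> x t = x 0 + integral {0..t} g"
    using assms absolutely_integrable_on_def unfolding has_W11_derivative_def by blast+
  then have "continuous_on {0..T} (\<lambda>t. x 0 + integral {0..t} g)"
    by (intro continuous_intros indefinite_integral_continuous_1)
  then show ?thesis by (rule continuous_on_eq) (rule x[symmetric])
qed

text \<open>
  The right-hand side of the adjoint equation is continuous, so the equation, required almost
  everywhere only, holds at every time.
\<close>

lemma adjoint_has_derivative:
  fixes M :: "real^'d^'d"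
  assumes "adjoint_solution T M p"
  shows "continuous_on {0..T} p"
    and "\<And>t. t \<in> {0..T} \<Longrightarrow> (p has_vector_derivative - (transpose M *v p t)) (at t within {0..T})"
proof -
  obtain g where g: "has_W11_derivative p g T"
      and ode: "AE t in lebesgue_on {0..T}. - g t = transpose M *v p t"
    using assms unfolding adjoint_solution_def by blast
  have p: "p t = p 0 + integral {0..t} g" if "t \<in> {0..T}" for t
    using g that unfolding has_W11_derivative_def by blast
  show cont: "continuous_on {0..T} p" by (rule W11_imp_continuous_on[OF g])
  let ?h = "\<lambda>t. - (transpose M *v p t)"
  have conth: "continuous_on {0..T} ?h"
    by (intro continuous_on_minus bounded_linear.continuous_on[OF matrix_vector_mul_bounded_linear] cont)
  obtain N where negl: "negligible N" and N: "\<And>t. t \<in> {0..T} - N \<Longrightarrow> - g t = transpose M *v p t"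
    using AE_lebesgue_on_negligibleE[OF ode] by auto
  have eq: "g t = ?h t" if "t \<in> {0..T} - N" for t
    using N[OF that] by (metis minus_minus)
  have int: "integral {0..t} g = integral {0..t} ?h" if "t \<in> {0..T}" for t
  proof (rule integral_spike[OF negl])
    fix s assume "s \<in> {0..t} - N"
    then show "?h s = g s" using that by (intro eq[symmetric]) auto
  qed
  fix t assume t: "t \<in> {0..T}"
  have "((\<lambda>t. integral {0..t} ?h) has_vector_derivative ?h t) (at t within {0..T})"
    by (rule integral_has_vector_derivative[OF conth t])
  then have "((\<lambda>t. p 0 + integral {0..t} ?h) has_vector_derivative ?h t) (at t within {0..T})"
    using has_vector_derivative_add[OF has_vector_derivative_const] by fastforce
  then show "(p has_vector_derivative ?h t) (at t within {0..T})"
    by (rule has_vector_derivative_transform[OF t, rotated]) (metis p int)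
qed

text \<open>
  Differentiating \<open>p t \<bullet> c\<close> moves one factor \<open>- M\<close> onto \<open>c\<close>; the series is the Taylor
  expansion at the terminal time, whose remainders are bounded by those of an exponential.
\<close>

lemma adjoint_taylor_series:
  fixes M :: "real^'d^'d"
  assumes p: "adjoint_solution T M p"
    and M: "\<And>x. norm (M *v x) \<le> R * norm x" "R \<ge> 0"
    and s: "s \<in> {0..T}"
  shows "(\<lambda>k. (p T \<bullet> (matpow M k *v c)) / fact k * s ^ k) sums (p (T - s) \<bullet> c)"
proof -
  define f where "f k t = (-1) ^ k * (p t \<bullet> (matpow M k *v c))" for k t
  have "compact (p ` {0..T})"
    by (intro compact_continuous_image adjoint_has_derivative(1)[OF p]) auto
  then obtain P where P: "P \<ge> 0" "\<And>t. t \<in> {0..T} \<Longrightarrow> norm (p t) \<le> P"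
    by (metis bounded_pos compact_imp_bounded image_eqI less_imp_le)
  have der: "(f k has_field_derivative f (Suc k) t) (at t within {0..T})" if "t \<in> {0..T}" for k t
  proof -
    have "((\<lambda>t. p t \<bullet> (matpow M k *v c)) has_vector_derivative
        (- (transpose M *v p t)) \<bullet> (matpow M k *v c)) (at t within {0..T})"
      using bounded_linear.has_vector_derivative[OF bounded_linear_inner_left
          adjoint_has_derivative(2)[OF p that]] .
    also have "(- (transpose M *v p t)) \<bullet> (matpow M k *v c) = - (p t \<bullet> (matpow M (Suc k) *v c))"
      by (simp add: matpow_Suc matrix_vector_mul_assoc[symmetric] dot_lmul_matrix
          transpose_matrix_vector)
    finally have "((\<lambda>t. p t \<bullet> (matpow M k *v c)) has_field_derivative
        - (p t \<bullet> (matpow M (Suc k) *v c))) (at t within {0..T})"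
      by (simp add: has_real_derivative_iff_has_vector_derivative)
    from DERIV_cmult[OF this, of "(-1) ^ k"] show ?thesis
      by (simp add: f_def[abs_def])
  qed
  \<comment> \<open>\<open>E n\<close> bounds the Taylor remainder of order \<open>n\<close>.\<close>
  define E where "E n = P * norm c * R * ((R * s) ^ n / fact n) * s" for n
  have bound: "norm (f 0 (T - s) - (\<Sum>i\<le>n. f i T * ((T - s) - T) ^ i / fact i)) \<le> E n" for n
  proof -
    have "norm (f 0 (T - s) - (\<Sum>i\<le>n. f i T * ((T - s) - T) ^ i / fact i))
        \<le> (P * (R ^ Suc n * norm c)) * norm ((T - s) - T) ^ Suc n / fact n"
    proof (rule field_Taylor[where S = "{0..T}" and f = f])
      fix t assume "t \<in> {0..T}"
      have "norm (f (Suc n) t) \<le> norm (p t) * norm (matpow M (Suc n) *v c)"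
        unfolding f_def using Cauchy_Schwarz_ineq2 by (simp add: abs_mult)
      also have "\<dots> \<le> P * (R ^ Suc n * norm c)"
        by (intro mult_mono P norm_matpow_vec_le M) (use P \<open>t \<in> {0..T}\<close> in auto)
      finally show "norm (f (Suc n) t) \<le> P * (R ^ Suc n * norm c)" .
    qed (use s der in auto)
    also have "\<dots> = E n" using s by (simp add: E_def power_mult_distrib field_simps)
    finally show ?thesis .
  qed
  have "E \<longlonglongrightarrow> P * norm c * R * 0 * s"
  proof -
    have "(\<lambda>n. (R * s) ^ n / fact n) \<longlonglongrightarrow> 0"
      using summable_LIMSEQ_zero[OF summable_exp[of "R * s"]] by (simp add: field_simps)
    then show ?thesis unfolding E_def by (intro tendsto_intros)
  qed
  then have "E \<longlonglongrightarrow> 0" by simp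
  have summand: "f i T * ((T - s) - T) ^ i / fact i = (p T \<bullet> (matpow M i *v c)) / fact i * s ^ i" for i
  proof -
    have sgn: "(-1::real) ^ i * (-1) ^ i = 1" by (simp flip: power_mult_distrib)
    have "f i T * ((T - s) - T) ^ i / fact i
        = ((-1) ^ i * (-1) ^ i) * ((p T \<bullet> (matpow M i *v c)) / fact i * s ^ i)"
      using power_minus[of s i] by (simp only: f_def) simp
    then show ?thesis by (simp only: sgn mult_1)
  qed
  have "(\<lambda>n. f 0 (T - s) - (\<Sum>i\<le>n. f i T * ((T - s) - T) ^ i / fact i)) \<longlonglongrightarrow> 0"
    by (rule Lim_null_comparison[OF _ \<open>E \<longlonglongrightarrow> 0\<close>]) (use bound in auto)
  then have "(\<lambda>n. f 0 (T - s) - (f 0 (T - s) - (\<Sum>i\<le>n. f i T * ((T - s) - T) ^ i / fact i)))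
     \<longlonglongrightarrow> f 0 (T - s) - 0"
    by (intro tendsto_intros)
  then show ?thesis unfolding sums_def_le summand by (simp add: f_def)
qed

section \<open>Integrability of the coefficients\<close>

lemma power_series_tail_bound:
  fixes a :: "nat \<Rightarrow> real"
  assumes a: "\<And>k. \<bar>a k\<bar> \<le> K ^ k * S" and K: "K \<ge> 0" and h: "0 < h" "h \<le> 1"
    and F: "(\<lambda>k. a k / fact k * h ^ k) sums F"
  shows "\<bar>F - (\<Sum>k\<le>i. a k / fact k * h ^ k)\<bar> \<le> h ^ Suc i * exp K * S"
proof -
  have "(\<lambda>k. a (k + Suc i) / fact (k + Suc i) * h ^ (k + Suc i)) sums
      (F - (\<Sum>k<Suc i. a k / fact k * h ^ k))"
    by (rule sums_split_initial_segment[OF F])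
  then have 1: "(\<lambda>k. a (k + Suc i) / fact (k + Suc i) * h ^ (k + Suc i)) sums
      (F - (\<Sum>k\<le>i. a k / fact k * h ^ k))"
    by (simp only: lessThan_Suc_atMost)
  have "(\<lambda>k. K ^ k / fact k) sums exp K"
    using exp_converges[of K] by (simp add: field_simps scaleR_conv_of_real)
  then have 2: "(\<lambda>k. K ^ (k + Suc i) / fact (k + Suc i)) sums
      (exp K - (\<Sum>k<Suc i. K ^ k / fact k))"
    by (rule sums_split_initial_segment)
  have S: "S \<ge> 0" using a[of 0] by simp
  have le: "\<bar>a (k + Suc i) / fact (k + Suc i) * h ^ (k + Suc i)\<bar>
      \<le> h ^ Suc i * S * (K ^ (k + Suc i) / fact (k + Suc i))" for k
  proof -
    have "h ^ (k + Suc i) \<le> h ^ Suc i" using h by (intro power_decreasing) auto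
    then have "\<bar>a (k + Suc i)\<bar> * h ^ (k + Suc i) \<le> (K ^ (k + Suc i) * S) * h ^ Suc i"
      using h K S by (intro mult_mono a) auto
    then show ?thesis using h
      by (simp add: abs_mult divide_right_mono mult_ac del: power_Suc)
  qed
  have "\<bar>F - (\<Sum>k\<le>i. a k / fact k * h ^ k)\<bar> \<le> h ^ Suc i * S * (exp K - (\<Sum>k<Suc i. K ^ k / fact k))"
  proof -
    let ?t = "\<lambda>k. a (k + Suc i) / fact (k + Suc i) * h ^ (k + Suc i)"
    note 3 = sums_mult[OF 2, of "h ^ Suc i * S"]
    have "norm (suminf ?t) \<le> (\<Sum>k. h ^ Suc i * S * (K ^ (k + Suc i) / fact (k + Suc i)))"
      by (rule norm_suminf_le[OF _ sums_summable[OF 3]]) (use le in \<open>simp del: power_Suc\<close>)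
    then show ?thesis unfolding sums_unique[OF 1, symmetric] sums_unique[OF 3, symmetric] by simp
  qed
  also have "\<dots> \<le> h ^ Suc i * S * exp K"
  proof -
    have "(\<Sum>k<Suc i. K ^ k / fact k) \<ge> 0" using K by (intro sum_nonneg) simp
    then show ?thesis using h S by (intro mult_left_mono) auto
  qed
  finally show ?thesis by (simp add: mult_ac)
qed

text \<open>
  The \<open>i\<close>-th coefficient is recovered from one value of the series and the earlier coefficients,
  with an error proportional to the step \<open>h\<close> times the bound \<open>S\<close> of the leading coefficients.
\<close>

lemma power_series_coefficient_error:
  fixes a :: "nat \<Rightarrow> real"
  assumes a: "\<And>k. \<bar>a k\<bar> \<le> K ^ k * S" and K: "K \<ge> 0" and h: "0 < h" "h \<le> 1"
    and F: "(\<lambda>k. a k / fact k * h ^ k) sums F"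
  shows "\<bar>fact i / h ^ i * (F - (\<Sum>k<i. a k / fact k * h ^ k)) - a i\<bar> \<le> fact i * exp K * h * S"
proof -
  have "fact i / h ^ i * (F - (\<Sum>k<i. a k / fact k * h ^ k)) - a i
      = fact i / h ^ i * (F - (\<Sum>k\<le>i. a k / fact k * h ^ k))"
    using h by (simp add: lessThan_Suc_atMost[symmetric] algebra_simps)
  then have "\<bar>fact i / h ^ i * (F - (\<Sum>k<i. a k / fact k * h ^ k)) - a i\<bar>
      = fact i / h ^ i * \<bar>F - (\<Sum>k\<le>i. a k / fact k * h ^ k)\<bar>"
    using h by (simp add: abs_mult)
  also have "\<dots> \<le> fact i / h ^ i * (h ^ Suc i * exp K * S)"
    using h by (intro mult_left_mono power_series_tail_bound[OF a K h F]) auto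
  also have "\<dots> = fact i * exp K * h * S" using h by simp
  finally show ?thesis .
qed

text \<open>
  A family of exponential series over a measure space that is known to be integrable only at each
  separate time, and whose coefficients are all controlled by the first \<open>d\<close> of them.  The series of
  \<open>adjoint_taylor_series\<close>, indexed by the uncertain parameter, have this form.
\<close>

locale exponential_coefficients =
  fixes M :: "'a measure" and a :: "nat \<Rightarrow> 'a \<Rightarrow> real" and F :: "real \<Rightarrow> 'a \<Rightarrow> real"
    and K T :: real and d :: nat
  assumes growth: "\<And>k x. \<bar>a k x\<bar> \<le> K ^ k * (\<Sum>j<d. \<bar>a j x\<bar>)"
    and K: "K \<ge> 0" and T: "T > 0"
    and series: "\<And>s x. s \<in> {0..T} \<Longrightarrow> (\<lambda>k. a k x / fact k * s ^ k) sums F s x"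
    and integrable_F: "\<And>s. s \<in> {0..T} \<Longrightarrow> integrable M (F s)"
begin

text \<open>
  Each coefficient is a pointwise limit of difference quotients as the step tends to \<open>0\<close>.
\<close>

lemma measurable_coefficient: "a i \<in> borel_measurable M"
proof (induction i rule: less_induct)
  case (less i)
  define h where "h n = min 1 T / real (Suc n)" for n
  have h: "0 < h n" "h n \<le> 1" "h n \<le> T" for n
  proof -
    have "min 1 T / real (Suc n) \<le> min 1 T" using T divide_left_mono[of 1 "real (Suc n)" "min 1 T"] by simp
    then show "0 < h n" "h n \<le> 1" "h n \<le> T" using T unfolding h_def by auto
  qed
  have "(\<lambda>n. min 1 T / real (Suc n)) \<longlonglongrightarrow> 0"
    by (intro real_tendsto_divide_at_top[OF tendsto_const] filterlim_compose[OF filterlim_real_sequentially filterlim_Suc])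
  then have h0: "h \<longlonglongrightarrow> 0" unfolding h_def .
  show ?case
  proof (rule borel_measurable_LIMSEQ_real)
    fix x
    have "(\<lambda>n. fact i * exp K * h n * (\<Sum>j<d. \<bar>a j x\<bar>)) \<longlonglongrightarrow> fact i * exp K * 0 * (\<Sum>j<d. \<bar>a j x\<bar>)"
      by (intro tendsto_intros h0)
    then have "(\<lambda>n. fact i * exp K * h n * (\<Sum>j<d. \<bar>a j x\<bar>)) \<longlonglongrightarrow> 0" by simp
    then have "(\<lambda>n. fact i / h n ^ i * (F (h n) x - (\<Sum>k<i. a k x / fact k * h n ^ k)) - a i x) \<longlonglongrightarrow> 0"
      by (rule Lim_null_comparison[rotated], intro always_eventually allI)
         (use power_series_coefficient_error[OF growth K h(1,2) series] h in \<open>auto simp: less_imp_le\<close>)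
    then show "(\<lambda>n. fact i / h n ^ i * (F (h n) x - (\<Sum>k<i. a k x / fact k * h n ^ k))) \<longlonglongrightarrow> a i x"
      by (simp add: LIM_zero_iff)
  next
    fix n
    have "F (h n) \<in> borel_measurable M"
      using integrable_F[of "h n"] h[of n] by (intro borel_measurable_integrable) auto
    then show "(\<lambda>x. fact i / h n ^ i * (F (h n) x - (\<Sum>k<i. a k x / fact k * h n ^ k))) \<in> borel_measurable M"
      by (intro borel_measurable_times borel_measurable_diff borel_measurable_sum borel_measurable_divide
          borel_measurable_const less) auto
  qed
qed

text \<open>
  Here the step is fixed, once for all points, so that the error of the difference quotient is at most
  \<open>\<epsilon> / 2\<close> times the sum of the leading coefficients.  The other half of \<open>\<epsilon>\<close> is spent on the
  earlier coefficients, which the quotient multiplies by large constants and which are therefore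
  needed with a much smaller error \<open>\<delta>\<close>.
\<close>

lemma coefficient_almost_dominated:
  assumes "\<epsilon> > 0"
  shows "\<exists>g. integrable M g \<and> (\<forall>x. \<bar>a i x\<bar> \<le> g x + \<epsilon> * (\<Sum>j<d. \<bar>a j x\<bar>))"
  using assms
proof (induction i arbitrary: \<epsilon> rule: less_induct)
  case (less i)
  define S where "S x = (\<Sum>j<d. \<bar>a j x\<bar>)" for x
  have S0: "S x \<ge> 0" for x unfolding S_def by (simp add: sum_nonneg)
  define h where "h = min (min 1 T) (\<epsilon> / (2 * (fact i * exp K)))"
  have "\<epsilon> / (2 * (fact i * exp K)) > 0" using less.prems by simp
  then have h: "0 < h" "h \<le> 1" "h \<le> T" and hE: "h \<le> \<epsilon> / (2 * (fact i * exp K))"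
    using T by (auto simp: h_def)
  have hE': "fact i * exp K * h \<le> \<epsilon> / 2"
    using hE by (simp add: field_simps)
  define c where "c k = fact i / h ^ i * (h ^ k / fact k)" for k
  have c0: "c k \<ge> 0" for k using h by (simp add: c_def)
  define \<delta> where "\<delta> = \<epsilon> / (2 * (1 + (\<Sum>k<i. c k)))"
  have C: "(\<Sum>k<i. c k) \<ge> 0" by (intro sum_nonneg c0)
  have \<delta>: "\<delta> > 0" using C less.prems by (simp add: \<delta>_def)
  have \<delta>E: "(\<Sum>k<i. c k) * \<delta> \<le> \<epsilon> / 2"
    using C less.prems by (simp add: \<delta>_def field_simps)
  have "\<forall>k\<in>{..<i}. \<exists>g. integrable M g \<and> (\<forall>x. \<bar>a k x\<bar> \<le> g x + \<delta> * S x)"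
    using less.IH[OF _ \<delta>] unfolding S_def by blast
  then obtain g where g: "\<And>k. k < i \<Longrightarrow> integrable M (g k)"
      "\<And>k x. k < i \<Longrightarrow> \<bar>a k x\<bar> \<le> g k x + \<delta> * S x"
    by (auto dest!: bchoice)
  define G where "G x = fact i / h ^ i * \<bar>F h x\<bar> + (\<Sum>k<i. c k * g k x)" for x
  have "integrable M G" unfolding G_def
    using h g(1) by (intro Bochner_Integration.integrable_add integrable_mult_right
        Bochner_Integration.integrable_sum integrable_abs integrable_F) auto
  moreover have "\<bar>a i x\<bar> \<le> G x + \<epsilon> * S x" for x
  proof -
    have "\<bar>fact i / h ^ i * (F h x - (\<Sum>k<i. a k x / fact k * h ^ k)) - a i x\<bar> \<le> fact i * exp K * h * S x"
      unfolding S_def using h by (intro power_series_coefficient_error growth K series) auto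
    also have "\<dots> \<le> \<epsilon> / 2 * S x" by (intro mult_right_mono hE' S0)
    finally have 1: "\<bar>a i x\<bar> \<le> \<bar>fact i / h ^ i * (F h x - (\<Sum>k<i. a k x / fact k * h ^ k))\<bar> + \<epsilon> / 2 * S x"
      by linarith
    have "fact i / h ^ i * (F h x - (\<Sum>k<i. a k x / fact k * h ^ k))
        = fact i / h ^ i * F h x - (\<Sum>k<i. c k * a k x)"
      by (simp add: c_def right_diff_distrib sum_distrib_left mult_ac)
    moreover have "\<bar>fact i / h ^ i * F h x\<bar> = fact i / h ^ i * \<bar>F h x\<bar>"
      using h by (simp add: abs_mult)
    moreover have "\<bar>\<Sum>k<i. c k * a k x\<bar> \<le> (\<Sum>k<i. c k * (g k x + \<delta> * S x))"
      by (rule order_trans[OF sum_abs], rule sum_mono)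
         (use g(2) c0 in \<open>auto simp: abs_mult intro!: mult_left_mono\<close>)
    ultimately have 2: "\<bar>fact i / h ^ i * (F h x - (\<Sum>k<i. a k x / fact k * h ^ k))\<bar>
        \<le> fact i / h ^ i * \<bar>F h x\<bar> + (\<Sum>k<i. c k * (g k x + \<delta> * S x))" by linarith
    have 3: "(\<Sum>k<i. c k * (g k x + \<delta> * S x)) = (\<Sum>k<i. c k * g k x) + (\<Sum>k<i. c k) * \<delta> * S x"
      by (simp add: distrib_left sum.distrib sum_distrib_right mult.assoc)
    have "(\<Sum>k<i. c k) * \<delta> * S x \<le> \<epsilon> / 2 * S x" by (intro mult_right_mono \<delta>E S0)
    with 1 2 3 show ?thesis unfolding G_def by (simp add: field_simps)
  qed
  ultimately show ?case unfolding S_def by blast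
qed

text \<open>
  Adding up \<open>coefficient_almost_dominated\<close> over the first \<open>d\<close> coefficients, with \<open>\<epsilon>\<close> so small
  that \<open>d * \<epsilon> \<le> 1 / 2\<close>, bounds half of their sum by an integrable function.
\<close>

lemma integrable_coefficient: "integrable M (a i)"
proof -
  define S where "S x = (\<Sum>j<d. \<bar>a j x\<bar>)" for x
  have S0: "S x \<ge> 0" for x unfolding S_def by (simp add: sum_nonneg)
  define \<epsilon> where "\<epsilon> = 1 / (2 * (1 + real d))"
  have \<epsilon>: "\<epsilon> > 0" "real d * \<epsilon> \<le> 1 / 2" by (simp_all add: \<epsilon>_def field_simps)
  obtain g where g: "\<And>k. integrable M (g k)" "\<And>k x. \<bar>a k x\<bar> \<le> g k x + \<epsilon> * S x"
    using coefficient_almost_dominated[OF \<epsilon>(1)] unfolding S_def by metis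
  have SG: "S x \<le> 2 * (\<Sum>k<d. g k x)" for x
  proof -
    have "S x \<le> (\<Sum>k<d. g k x + \<epsilon> * S x)" unfolding S_def[of x]
      by (rule sum_mono) (use g(2) S_def in simp)
    also have "\<dots> = (\<Sum>k<d. g k x) + real d * \<epsilon> * S x" by (simp add: sum.distrib)
    also have "\<dots> \<le> (\<Sum>k<d. g k x) + 1 / 2 * S x"
      by (intro add_left_mono mult_right_mono \<epsilon> S0)
    finally show ?thesis by simp
  qed
  show ?thesis
  proof (rule Bochner_Integration.integrable_bound)
    show "integrable M (\<lambda>x. K ^ i * (2 * (\<Sum>k<d. g k x)))"
      by (intro integrable_mult_right Bochner_Integration.integrable_sum g)
    show "AE x in M. norm (a i x) \<le> norm (K ^ i * (2 * (\<Sum>k<d. g k x)))"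
    proof (intro always_eventually allI)
      fix x
      have "norm (a i x) \<le> K ^ i * S x" using growth[of i x] by (simp add: S_def)
      also have "\<dots> \<le> K ^ i * (2 * (\<Sum>k<d. g k x))" using K by (intro mult_left_mono SG) simp
      finally show "norm (a i x) \<le> norm (K ^ i * (2 * (\<Sum>k<d. g k x)))" by simp
    qed
  qed (rule measurable_coefficient)
qed

lemma integral_growth:
  "(LINT x|M. \<bar>a k x\<bar>) \<le> K ^ k * (\<Sum>j<d. LINT x|M. \<bar>a j x\<bar>)"
proof -
  have "(LINT x|M. \<bar>a k x\<bar>) \<le> (LINT x|M. K ^ k * (\<Sum>j<d. \<bar>a j x\<bar>))"
    by (intro integral_mono integrable_mult_right Bochner_Integration.integrable_sum
        integrable_abs integrable_coefficient growth)
  also have "\<dots> = K ^ k * (\<Sum>j<d. LINT x|M. \<bar>a j x\<bar>)"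
    by (simp add: integrable_coefficient)
  finally show ?thesis .
qed

lemma integral_series:
  assumes s: "s \<in> {0..T}"
  shows "(\<lambda>k. (LINT x|M. a k x) / fact k * s ^ k) sums (LINT x|M. F s x)"
proof -
  have exps: "summable (\<lambda>k. (K ^ k * B) / fact k * s ^ k)" for B :: real
    using summable_mult[OF summable_exp[of "K * s"], of B]
    by (simp add: power_mult_distrib field_simps)
  have "(\<lambda>k. LINT x|M. a k x / fact k * s ^ k) sums (LINT x|M. (\<Sum>k. a k x / fact k * s ^ k))"
  proof (rule sums_integral)
    show "integrable M (\<lambda>x. a k x / fact k * s ^ k)" for k
      using integrable_coefficient by simp
    show "AE x in M. summable (\<lambda>k. norm (a k x / fact k * s ^ k))"
    proof (intro always_eventually allI)
      fix x
      show "summable (\<lambda>k. norm (a k x / fact k * s ^ k))"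
        by (rule summable_comparison_test'[OF exps[of "\<Sum>j<d. \<bar>a j x\<bar>"]])
           (use growth[of _ x] s in \<open>auto simp: abs_mult intro!: divide_right_mono mult_right_mono\<close>)
    qed
    show "summable (\<lambda>k. LINT x|M. norm (a k x / fact k * s ^ k))"
      by (rule summable_comparison_test'[OF exps[of "\<Sum>j<d. LINT x|M. \<bar>a j x\<bar>"]])
         (use integral_growth s in \<open>auto simp: abs_mult intro!: divide_right_mono mult_right_mono integral_nonneg\<close>)
  qed
  moreover have "(\<Sum>k. a k x / fact k * s ^ k) = F s x" for x
    using series[OF s] by (simp add: sums_iff)
  ultimately show ?thesis by simp
qed

end

section \<open>Level sets of entire series\<close>

text \<open>
  The series extends to a holomorphic function on a disc around the compact interval, where a
  nonconstant holomorphic function takes each value only finitely often.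
\<close>

lemma entire_series_constant_of_infinite_level_set:
  fixes c :: "nat \<Rightarrow> real"
  assumes c: "\<And>k. \<bar>c k\<bar> \<le> K ^ k * B"
    and f: "\<And>s. s \<in> {0..T} \<Longrightarrow> (\<lambda>k. c k / fact k * s ^ k) sums f s"
    and inf: "infinite {s \<in> {0..T}. f s = y}"
  shows "c 0 = y \<and> (\<forall>k>0. c k = 0)"
proof -
  have T: "T \<ge> 0" using inf by (cases "T \<ge> 0") auto
  define r where "r = T + 1"
  define C where "C k = complex_of_real (c k / fact k)" for k
  define g where "g z = (\<Sum>k. C k * z ^ k)" for z
  have summ: "summable (\<lambda>k. C k * z ^ k)" for z
  proof (rule summable_comparison_test')
    show "summable (\<lambda>k. B * ((K * norm z) ^ k /\<^sub>R fact k))"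
      by (intro summable_mult summable_exp_generic)
    show "norm (C k * z ^ k) \<le> B * ((K * norm z) ^ k /\<^sub>R fact k)" for k
    proof -
      have "norm (C k * z ^ k) = \<bar>c k\<bar> * norm z ^ k / fact k"
        by (simp add: C_def norm_mult norm_power norm_divide)
      also have "\<dots> \<le> (K ^ k * B) * norm z ^ k / fact k"
        by (intro divide_right_mono mult_right_mono c) auto
      finally show ?thesis by (simp add: power_mult_distrib field_simps)
    qed
  qed
  then have sums: "(\<lambda>k. C k * z ^ k) sums g z" for z
    unfolding g_def by (rule summable_sums)
  have hol: "g holomorphic_on ball 0 r"
    by (rule power_series_holomorphic[of _ _ C]) (use sums in simp)
  have gf: "g (of_real s) = of_real (f s)" if "s \<in> {0..T}" for s
    using sums_unique2[OF sums[of "of_real s"], of "of_real (f s)"] sums_of_real[OF f[OF that], where 'a = complex]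
    by (simp add: C_def)
  have "infinite (complex_of_real ` {s \<in> {0..T}. f s = y})"
    using inf by (subst finite_image_iff) (auto simp: inj_on_def)
  moreover have "complex_of_real ` {s \<in> {0..T}. f s = y}
      \<subseteq> {z \<in> complex_of_real ` {0..T}. g z - of_real y = 0}"
    using gf by auto
  ultimately have infg: "infinite {z \<in> complex_of_real ` {0..T}. g z - of_real y = 0}"
    using finite_subset by blast
  have "(\<lambda>z. g z - of_real y) constant_on ball 0 r"
  proof (rule ccontr)
    assume "\<not> (\<lambda>z. g z - of_real y) constant_on ball 0 r"
    then have "finite {z \<in> complex_of_real ` {0..T}. g z - of_real y = 0}"
      by (intro holomorphic_compact_finite_zeros[of _ "ball 0 r"] holomorphic_intros hol
          compact_continuous_image continuous_intros) (auto simp: r_def)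
    with infg show False by blast
  qed
  then obtain w where w: "\<And>z. z \<in> ball 0 r \<Longrightarrow> g z - of_real y = w" by (auto simp: constant_on_def)
  obtain s where s: "s \<in> {0..T}" "f s = y"
    using inf by (metis (mono_tags, lifting) empty_Collect_eq finite.emptyI)
  have "w = 0" using w[of "of_real s"] gf[OF s(1)] s T by (simp add: r_def)
  then have gy: "g z = of_real y" if "z \<in> ball 0 r" for z using w[OF that] by simp
  have c0: "c 0 = y"
  proof -
    have "g 0 = C 0" unfolding g_def by simp
    then show ?thesis using gy[of 0] T by (simp add: C_def r_def)
  qed
  moreover have "c k = 0" if kpos: "k > 0" for k
  proof (rule ccontr)
    assume k: "c k \<noteq> 0"
    define C' where "C' = (\<lambda>j. if j = 0 then 0 else C j)"
    have "(\<lambda>j. C' j * (z - 0) ^ j) sums (g z - of_real y)" for z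
    proof -
      have "(\<lambda>j. if j = 0 then C 0 else 0) sums C 0" by (rule sums_single)
      from sums_diff[OF sums this] have "(\<lambda>j. C j * z ^ j - (if j = 0 then C 0 else 0)) sums (g z - C 0)" .
      also have "(\<lambda>j. C j * z ^ j - (if j = 0 then C 0 else 0)) = (\<lambda>j. C' j * (z - 0) ^ j)"
        by (auto simp: C'_def)
      also have "C 0 = of_real y" using c0 by (simp add: C_def)
      finally show ?thesis .
    qed
    then obtain e where e: "e > 0" "\<And>z. z \<in> cball 0 e - {0} \<Longrightarrow> g z - of_real y \<noteq> 0"
      by (rule powser_0_nonzero[of r 0 C' "\<lambda>z. g z - of_real y" k, rotated])
         (use kpos k T gy[of 0] in \<open>auto simp: C'_def C_def r_def\<close>)
    define \<rho> where "\<rho> = min e (r / 2)"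
    have "0 < \<rho>" "\<rho> \<le> e" "\<rho> < r" using e(1) T by (auto simp: \<rho>_def r_def min_def field_simps)
    then have "complex_of_real \<rho> \<in> cball 0 e - {0}" "complex_of_real \<rho> \<in> ball 0 r" by auto
    then show False using e(2)[of "of_real \<rho>"] gy[of "of_real \<rho>"] by simp
  qed
  ultimately show ?thesis by blast
qed

section \<open>Continuous dependence of the terminal state\<close>

lemma norm_matrix_vector_mult_le:
  fixes M :: "real^'n^'m"
  shows "norm (M *v x) \<le> norm M * norm x"
proof -
  have "norm (M *v x) \<le> L2_set (\<lambda>i. norm (M $ i) * norm x) UNIV"
    unfolding norm_vec_def[of "M *v x"]
    by (rule L2_set_mono) (simp_all add: matrix_vector_mul_component Cauchy_Schwarz_ineq2)
  also have "\<dots> = norm M * norm x"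
    by (simp add: norm_vec_def[of M] L2_set_left_distrib)
  finally show ?thesis .
qed

text \<open>
  The quantity \<open>exp (- R * t) * (h t + \<epsilon> / R)\<close> is nonincreasing, where \<open>h\<close> is the integral that
  bounds \<open>y\<close>.
\<close>

lemma gronwall_inequality:
  fixes y :: "real \<Rightarrow> real"
  assumes y: "continuous_on {0..T} y" and R: "R > 0" and t: "t \<in> {0..T}"
    and le: "\<And>t. t \<in> {0..T} \<Longrightarrow> y t \<le> integral {0..t} (\<lambda>s. R * y s + \<epsilon>)"
  shows "y t \<le> \<epsilon> / R * (exp (R * t) - 1)"
proof -
  define h where "h t = integral {0..t} (\<lambda>s. R * y s + \<epsilon>)" for t
  define k where "k t = exp (- R * t) * (h t + \<epsilon> / R)" for t
  have h: "(h has_real_derivative R * y s + \<epsilon>) (at s within {0..T})" if "s \<in> {0..T}" for s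
    unfolding h_def has_real_derivative_iff_has_vector_derivative
    by (rule integral_has_vector_derivative) (use y that in \<open>auto intro!: continuous_intros\<close>)
  have k: "(k has_real_derivative exp (- R * s) * (R * y s - R * h s)) (at s within {0..T})"
    if "s \<in> {0..T}" for s
  proof -
    have "((\<lambda>t. exp (- R * t)) has_real_derivative - R * exp (- R * s)) (at s within {0..T})"
      by (auto intro!: derivative_eq_intros)
    moreover have "((\<lambda>t. h t + \<epsilon> / R) has_real_derivative R * y s + \<epsilon>) (at s within {0..T})"
      using DERIV_add[OF h[OF that] DERIV_const] by simp
    ultimately have "(k has_real_derivative
        - R * exp (- R * s) * (h s + \<epsilon> / R) + (R * y s + \<epsilon>) * exp (- R * s)) (at s within {0..T})"
      unfolding k_def by (rule DERIV_mult)
    moreover have "- R * exp (- R * s) * (h s + \<epsilon> / R) + (R * y s + \<epsilon>) * exp (- R * s)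
        = exp (- R * s) * (R * y s - R * h s)" using R by (simp add: algebra_simps)
    ultimately show ?thesis by simp
  qed
  have "k t \<le> k 0"
  proof (rule DERIV_nonpos_imp_decreasing_open[of 0 t k])
    show "0 \<le> t" using t by simp
    fix s assume s: "0 < s" "s < t"
    have "exp (- R * s) * (R * y s - R * h s) \<le> 0"
      using le[of s] s t R by (intro mult_nonneg_nonpos) (auto simp: h_def)
    moreover have "at s within {0..T} = at s"
      using s t by (intro at_within_interior) auto
    ultimately show "\<exists>d. (k has_real_derivative d) (at s) \<and> d \<le> 0"
      using k[of s] s t by auto
  next
    have "continuous_on {0..T} k"
      by (rule DERIV_continuous_on[OF k])
    then show "continuous_on {0..t} k" by (rule continuous_on_subset) (use t in auto)
  qed
  also have "k 0 = \<epsilon> / R" by (simp add: k_def h_def)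
  finally have "exp (R * t) * k t \<le> exp (R * t) * (\<epsilon> / R)" by (intro mult_left_mono) auto
  moreover have "exp (R * t) * k t = h t + \<epsilon> / R"
    by (simp add: k_def mult.assoc[symmetric] flip: exp_add)
  ultimately have "h t \<le> \<epsilon> / R * (exp (R * t) - 1)" by (simp add: algebra_simps)
  then show ?thesis using le[OF t] by (simp add: h_def)
qed

lemma state_dependence_bound:
  fixes M1 M2 :: "real^'d^'d"
  assumes x1: "state_solution T M1 c1 x0 u x1" and x2: "state_solution T M2 c2 x0 u x2"
    and u: "AE t in lebesgue_on {0..T}. u t \<in> {-1..1}"
    and R: "norm M1 \<le> R" "R > 0" and T: "T \<ge> 0"
    and X: "\<And>t. t \<in> {0..T} \<Longrightarrow> norm (x2 t) \<le> X"
  shows "norm (x1 T - x2 T) \<le> (norm (M1 - M2) * X + norm (c1 - c2)) / R * (exp (R * T) - 1)"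
proof -
  define \<epsilon> where "\<epsilon> = norm (M1 - M2) * X + norm (c1 - c2)"
  obtain g1 g2 where g1: "has_W11_derivative x1 g1 T" "AE t in lebesgue_on {0..T}. g1 t = M1 *v x1 t + u t *\<^sub>R c1"
    and g2: "has_W11_derivative x2 g2 T" "AE t in lebesgue_on {0..T}. g2 t = M2 *v x2 t + u t *\<^sub>R c2"
    and init: "x1 0 = x0" "x2 0 = x0"
    using x1 x2 unfolding state_solution_def by blast
  have "AE t in lebesgue_on {0..T}. u t \<in> {-1..1} \<and> g1 t = M1 *v x1 t + u t *\<^sub>R c1 \<and> g2 t = M2 *v x2 t + u t *\<^sub>R c2"
    using u g1(2) g2(2) by eventually_elim simp
  then obtain N where N: "negligible N" and eq: "\<And>t. t \<in> {0..T} - N \<Longrightarrow>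
      u t \<in> {-1..1} \<and> g1 t = M1 *v x1 t + u t *\<^sub>R c1 \<and> g2 t = M2 *v x2 t + u t *\<^sub>R c2"
    by (rule AE_lebesgue_on_negligibleE) auto
  \<comment> \<open>On the exceptional null set the derivative is reset to \<open>0\<close>, so that the bound holds everywhere.\<close>
  define w where "w t = (if t \<in> N then 0 else g1 t - g2 t)" for t
  have cont: "continuous_on {0..T} (\<lambda>t. norm (x1 t - x2 t))"
    by (intro continuous_intros W11_imp_continuous_on[OF g1(1)] W11_imp_continuous_on[OF g2(1)])
  have X0: "X \<ge> 0" using X[of 0] T by (meson atLeastAtMost_iff norm_ge_zero order.refl order_trans)
  then have \<epsilon>: "\<epsilon> \<ge> 0" by (simp add: \<epsilon>_def)
  have wle: "norm (w t) \<le> R * norm (x1 t - x2 t) + \<epsilon>" if t: "t \<in> {0..T}" for t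
  proof (cases "t \<in> N")
    case True
    then show ?thesis using R \<epsilon> by (simp add: w_def)
  next
    case False
    have "w t = M1 *v (x1 t - x2 t) + ((M1 - M2) *v x2 t + u t *\<^sub>R (c1 - c2))"
      using eq[of t] t False
      by (simp add: w_def matrix_vector_mult_diff_distrib matrix_vector_mult_diff_rdistrib algebra_simps)
    also have "norm \<dots> \<le> norm (M1 *v (x1 t - x2 t)) + (norm ((M1 - M2) *v x2 t) + norm (u t *\<^sub>R (c1 - c2)))"
      by (intro norm_triangle_le add_left_mono order.refl norm_triangle_ineq)
    also have "\<dots> \<le> R * norm (x1 t - x2 t) + (norm (M1 - M2) * X + 1 * norm (c1 - c2))"
    proof (intro add_mono)
      show "norm (M1 *v (x1 t - x2 t)) \<le> R * norm (x1 t - x2 t)"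
        using norm_matrix_vector_mult_le R(1) by (meson mult_right_mono norm_ge_zero order_trans)
      show "norm ((M1 - M2) *v x2 t) \<le> norm (M1 - M2) * X"
        using norm_matrix_vector_mult_le X[OF t] by (meson mult_left_mono norm_ge_zero order_trans)
      show "norm (u t *\<^sub>R (c1 - c2)) \<le> 1 * norm (c1 - c2)"
        unfolding norm_scaleR using eq[of t] t False by (intro mult_right_mono) auto
    qed
    finally show ?thesis by (simp add: \<epsilon>_def)
  qed
  have "norm (x1 T - x2 T) \<le> \<epsilon> / R * (exp (R * T) - 1)"
  proof (rule gronwall_inequality[OF cont])
    fix t assume t: "t \<in> {0..T}"
    have "g1 integrable_on {0..T}" "g2 integrable_on {0..T}"
      using g1(1) g2(1) absolutely_integrable_on_def unfolding has_W11_derivative_def by blast+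
    then have gi: "g1 integrable_on {0..t}" "g2 integrable_on {0..t}"
      using t by (auto intro: integrable_subinterval_real)
    have "x1 t - x2 t = integral {0..t} g1 - integral {0..t} g2"
      using g1(1) g2(1) t init unfolding has_W11_derivative_def by (metis add_diff_cancel_left)
    also have "\<dots> = integral {0..t} (\<lambda>s. g1 s - g2 s)"
      by (rule integral_diff[OF gi, symmetric])
    also have "\<dots> = integral {0..t} w"
      by (rule integral_spike[OF N]) (simp add: w_def)
    also have "norm \<dots> \<le> integral {0..t} (\<lambda>s. R * norm (x1 s - x2 s) + \<epsilon>)"
    proof (rule integral_norm_bound_integral)
      show "w integrable_on {0..t}"
        by (rule integrable_spike[OF integrable_diff[OF gi] N]) (simp add: w_def)
      show "(\<lambda>s. R * norm (x1 s - x2 s) + \<epsilon>) integrable_on {0..t}"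
        using t by (intro integrable_continuous_real continuous_intros continuous_on_subset[OF cont]) auto
    qed (use wle t in auto)
    finally show "norm (x1 t - x2 t) \<le> integral {0..t} (\<lambda>s. R * norm (x1 s - x2 s) + \<epsilon>)" .
  qed (use R T in auto)
  then show ?thesis unfolding \<epsilon>_def .
qed

lemma terminal_state_continuous_on:
  fixes A :: "real^'k \<Rightarrow> real^'d^'d"
  assumes S: "compact S" and A: "continuous_on S A" and b: "continuous_on S b"
    and u: "AE t in lebesgue_on {0..T}. u t \<in> {-1..1}" and T: "T \<ge> 0"
    and x: "\<And>\<alpha>. \<alpha> \<in> S \<Longrightarrow> state_solution T (A \<alpha>) (b \<alpha>) x0 u (x \<alpha>)"
  shows "continuous_on S (\<lambda>\<alpha>. x \<alpha> T)"
  unfolding continuous_on_def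
proof
  fix \<beta> assume \<beta>: "\<beta> \<in> S"
  obtain R where R: "R > 0" "\<And>\<alpha>. \<alpha> \<in> S \<Longrightarrow> norm (A \<alpha>) \<le> R"
    using compact_imp_bounded[OF compact_continuous_image[OF A S]] by (auto simp: bounded_pos)
  obtain g where "has_W11_derivative (x \<beta>) g T"
    using x[OF \<beta>] unfolding state_solution_def by blast
  then have "compact (x \<beta> ` {0..T})"
    by (intro compact_continuous_image W11_imp_continuous_on) auto
  then have "bounded (x \<beta> ` {0..T})" by (rule compact_imp_bounded)
  then obtain X where X: "\<And>t. t \<in> {0..T} \<Longrightarrow> norm (x \<beta> t) \<le> X"
    by (meson bounded_iff imageI)
  let ?E = "\<lambda>\<alpha>. (norm (A \<alpha> - A \<beta>) * X + norm (b \<alpha> - b \<beta>)) / R * (exp (R * T) - 1)"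
  have "(A \<longlongrightarrow> A \<beta>) (at \<beta> within S)" "(b \<longlongrightarrow> b \<beta>) (at \<beta> within S)"
    using A b \<beta> by (auto simp: continuous_on_def)
  then have "(?E \<longlongrightarrow> (norm (A \<beta> - A \<beta>) * X + norm (b \<beta> - b \<beta>)) / R * (exp (R * T) - 1)) (at \<beta> within S)"
    using R(1) by (intro tendsto_intros) auto
  then have E: "(?E \<longlongrightarrow> 0) (at \<beta> within S)" by simp
  have "((\<lambda>\<alpha>. x \<alpha> T - x \<beta> T) \<longlongrightarrow> 0) (at \<beta> within S)"
  proof (rule Lim_null_comparison[OF _ E])
    show "\<forall>\<^sub>F \<alpha> in at \<beta> within S. norm (x \<alpha> T - x \<beta> T) \<le> ?E \<alpha>"
      unfolding eventually_at_filter
      by (intro always_eventually allI impI state_dependence_bound[OF x x[OF \<beta>] u R(2,1) T X])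
  qed
  then show "((\<lambda>\<alpha>. x \<alpha> T) \<longlongrightarrow> x \<beta> T) (at \<beta> within S)"
    by (simp add: LIM_zero_iff)
qed

section \<open>Gradients and normal vectors\<close>

lemma C1_on_imp_continuous_on:
  assumes "C1_on W f" "S \<subseteq> W"
  shows "continuous_on S f"
proof -
  have "continuous_on W f"
    using assms(1) unfolding C1_on_def
    by (meson continuous_at_imp_continuous_on has_derivative_continuous)
  then show ?thesis using assms(2) continuous_on_subset by blast
qed

lemma C1_on_gradient:
  fixes f :: "'a::euclidean_space \<Rightarrow> real"
  assumes "C1_on UNIV f"
  shows "(f has_derivative (\<lambda>h. gradient f x \<bullet> h)) (at x)"
    and "continuous_on UNIV (gradient f)"
proof -
  obtain f' where f': "\<And>x. (f has_derivative blinfun_apply (f' x)) (at x)" "continuous_on UNIV f'"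
    using assms by (auto simp: C1_on_def)
  define g where "g x = (\<Sum>i\<in>Basis. blinfun_apply (f' x) i *\<^sub>R i)" for x
  have app: "blinfun_apply (f' x) h = h \<bullet> g x" for x h
  proof -
    have "blinfun_apply (f' x) h = blinfun_apply (f' x) (\<Sum>i\<in>Basis. (h \<bullet> i) *\<^sub>R i)"
      by (simp add: euclidean_representation)
    also have "\<dots> = h \<bullet> g x"
      by (simp add: g_def blinfun.sum_right blinfun.scaleR_right inner_sum_right mult.commute)
    finally show ?thesis .
  qed
  have D: "GDERIV f x :> g x" for x
    unfolding gderiv_def using f'(1)[of x] by (simp add: app[abs_def])
  have "gradient f x = g x" for x
    unfolding gradient_def
  proof (rule the_equality)
    fix d assume "GDERIV f x :> d"
    then have "(\<lambda>h. h \<bullet> d) = (\<lambda>h. h \<bullet> g x)"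
      using D[of x] unfolding gderiv_def by (rule has_derivative_unique)
    then show "d = g x" by (metis vector_eq_ldot)
  qed (rule D)
  then have grad: "gradient f = g" by (rule ext)
  show "(f has_derivative (\<lambda>h. gradient f x \<bullet> h)) (at x)"
    using D[of x] by (simp add: grad gderiv_def inner_commute)
  show "continuous_on UNIV (gradient f)"
    unfolding grad g_def[abs_def] by (intro continuous_intros f'(2))
qed

text \<open>
  If the gradient had a positive component towards a point \<open>y\<close> of the terminal set, \<open>\<psi>\<close> would be
  positive shortly after leaving \<open>\<xi>\<close> towards \<open>y\<close>, whereas convexity keeps it nonpositive on the
  whole segment.
\<close>

lemma gradient_in_normal_cone:
  assumes f: "C1_on UNIV \<psi>" "convex_on UNIV \<psi>" and \<xi>: "\<psi> \<xi> = 0" and r: "r \<ge> 0"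
  shows "r *\<^sub>R gradient \<psi> \<xi> \<in> normal_cone (terminal_set \<psi>) \<xi>"
proof -
  have "gradient \<psi> \<xi> \<bullet> (y - \<xi>) \<le> 0" if y: "\<psi> y \<le> 0" for y
  proof (rule ccontr)
    assume "\<not> gradient \<psi> \<xi> \<bullet> (y - \<xi>) \<le> 0"
    then have pos: "gradient \<psi> \<xi> \<bullet> (y - \<xi>) > 0" by simp
    define \<omega> where "\<omega> t = \<psi> (\<xi> + t *\<^sub>R (y - \<xi>))" for t :: real
    have "((\<lambda>t. \<xi> + t *\<^sub>R (y - \<xi>)) has_derivative (\<lambda>t. t *\<^sub>R (y - \<xi>))) (at 0)"
      by (auto intro!: derivative_eq_intros)
    moreover have "(\<psi> has_derivative (\<lambda>h. gradient \<psi> \<xi> \<bullet> h)) (at (\<xi> + 0 *\<^sub>R (y - \<xi>)))"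
      using C1_on_gradient(1)[OF f(1)] by simp
    ultimately have "(\<omega> has_derivative (\<lambda>t. gradient \<psi> \<xi> \<bullet> (t *\<^sub>R (y - \<xi>)))) (at 0)"
      unfolding \<omega>_def by (rule has_derivative_compose)
    then have "(\<omega> has_real_derivative gradient \<psi> \<xi> \<bullet> (y - \<xi>)) (at 0)"
      by (simp add: has_field_derivative_def mult_commute_abs)
    then obtain e where e: "e > 0" "\<And>h. 0 < h \<Longrightarrow> h < e \<Longrightarrow> \<omega> 0 < \<omega> (0 + h)"
      using DERIV_pos_inc_right[OF _ pos] by blast
    define h where "h = min (e / 2) 1"
    have h: "0 < h" "h < e" "h \<le> 1" using e(1) by (auto simp: h_def)
    have "\<omega> h = \<psi> ((1 - h) *\<^sub>R \<xi> + h *\<^sub>R y)" by (simp add: \<omega>_def algebra_simps)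
    also have "\<dots> \<le> (1 - h) * \<psi> \<xi> + h * \<psi> y"
      using h by (intro convex_onD[OF f(2)]) auto
    also have "\<dots> \<le> 0" using h y \<xi> by (simp add: mult_nonneg_nonpos)
    finally show False using e(2)[OF h(1,2)] \<xi> by (simp add: \<omega>_def)
  qed
  then show ?thesis using r
    by (auto simp: normal_cone_def terminal_set_def mult_nonneg_nonpos)
qed

section \<open>Supports, maximizers and null sets\<close>

text \<open>
  The complement of the support is covered by null sets from a countable basis of the topology.
\<close>

lemma AE_in_measure_support:
  fixes M :: "'a::second_countable_topology measure"
  assumes M: "sets M = sets (restrict_space borel S)"
  shows "AE x in M. x \<in> measure_support M"
proof -
  obtain B :: "'a set set" where B: "countable B" "topological_basis B"
    using ex_countable_basis by blast
  define Z where "Z = (\<lambda>U. U \<inter> space M) ` {U \<in> B. emeasure M (U \<inter> space M) = 0}"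
  have sp: "space M = S" using sets_eq_imp_space_eq[OF M] by (simp add: space_restrict_space)
  have "(\<Union>A\<in>Z. A) \<in> null_sets M"
  proof (rule null_sets_UN')
    show "countable Z" unfolding Z_def using B(1) by simp
    fix A assume "A \<in> Z"
    then obtain U where U: "U \<in> B" "emeasure M (U \<inter> space M) = 0" "A = U \<inter> space M"
      by (auto simp: Z_def)
    moreover have "U \<inter> space M \<in> sets M"
      using topological_basis_open[OF B(2) U(1)] unfolding M sp
      by (auto simp: sets_restrict_space Int_commute)
    ultimately show "A \<in> null_sets M" by auto
  qed
  moreover have "{x \<in> space M. x \<notin> measure_support M} \<subseteq> (\<Union>A\<in>Z. A)"
  proof
    fix x assume "x \<in> {x \<in> space M. x \<notin> measure_support M}"
    then obtain U where x: "x \<in> space M" and U: "open U" "x \<in> U" "emeasure M (U \<inter> space M) = 0"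
      by (auto simp: measure_support_def)
    obtain V where V: "V \<in> B" "x \<in> V" "V \<subseteq> U"
      using topological_basisE[OF B(2) U(1,2)] by blast
    have "emeasure M (V \<inter> space M) \<le> emeasure M (U \<inter> space M)"
      using V(3) U(1) by (intro emeasure_mono) (auto simp: M sp sets_restrict_space Int_commute)
    then show "x \<in> (\<Union>A\<in>Z. A)" using U(3) V x by (auto simp: Z_def)
  qed
  ultimately show ?thesis by (rule AE_I')
qed

lemma arg_max_bang_off_bang:
  fixes \<phi> \<eta> w :: real
  assumes w: "is_arg_max (\<lambda>v. \<phi> * v - \<eta> * \<bar>v\<bar>) (\<lambda>v. v \<in> {-1..1}) w"
    and \<eta>: "\<eta> > 0" and "\<phi> \<noteq> \<eta>" "\<phi> \<noteq> - \<eta>"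
  shows "(\<phi> > \<eta> \<and> \<not> \<bar>\<phi>\<bar> < \<eta> \<and> \<not> \<phi> < - \<eta> \<and> w = 1) \<or>
         (\<not> \<phi> > \<eta> \<and> \<bar>\<phi>\<bar> < \<eta> \<and> \<not> \<phi> < - \<eta> \<and> w = 0) \<or>
         (\<not> \<phi> > \<eta> \<and> \<not> \<bar>\<phi>\<bar> < \<eta> \<and> \<phi> < - \<eta> \<and> w = -1)"
proof -
  have w1: "-1 \<le> w" "w \<le> 1" and
    max: "\<And>v. -1 \<le> v \<Longrightarrow> v \<le> 1 \<Longrightarrow> \<phi> * v - \<eta> * \<bar>v\<bar> \<le> \<phi> * w - \<eta> * \<bar>w\<bar>"
    using w by (auto simp: is_arg_max_def not_less)
  have 1: "w = 1" if "\<phi> > \<eta>"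
  proof -
    have "(\<phi> - \<eta>) * (1 - w) \<le> \<eta> * (w - \<bar>w\<bar>)"
      using max[of 1] by (simp add: algebra_simps)
    also have "\<dots> \<le> 0" using \<eta> by (intro mult_nonneg_nonpos) auto
    finally show ?thesis using that w1 by (simp add: mult_le_0_iff)
  qed
  have 2: "w = -1" if "\<phi> < - \<eta>"
  proof -
    have "(- \<phi> - \<eta>) * (1 + w) \<le> \<eta> * (- w - \<bar>w\<bar>)"
      using max[of "-1"] by (simp add: algebra_simps)
    also have "\<dots> \<le> 0" using \<eta> by (intro mult_nonneg_nonpos) auto
    finally show ?thesis using that w1 by (simp add: mult_le_0_iff)
  qed
  have 3: "w = 0" if "\<bar>\<phi>\<bar> < \<eta>"
  proof -
    have "\<eta> * \<bar>w\<bar> \<le> \<phi> * w" using max[of 0] by simp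
    also have "\<dots> \<le> \<bar>\<phi>\<bar> * \<bar>w\<bar>" by (metis abs_ge_self abs_mult)
    finally have "(\<eta> - \<bar>\<phi>\<bar>) * \<bar>w\<bar> \<le> 0" by (simp add: algebra_simps)
    then show ?thesis using that by (simp add: mult_le_0_iff)
  qed
  show ?thesis using 1 2 3 assms by linarith
qed

lemma continuous_on_matrix_vector_mult:
  fixes A :: "'a::topological_space \<Rightarrow> real^'n^'m"
  assumes "continuous_on S A" "continuous_on S f"
  shows "continuous_on S (\<lambda>x. A x *v f x)"
  unfolding matrix_vector_mult_def
  by (intro continuous_on_vec_lambda continuous_intros assms)

lemma finite_exceptional_times_AE:
  assumes "finite {t \<in> S. \<not> P t}" "S \<in> sets lebesgue"
  shows "AE t in lebesgue_on S. P t"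
proof -
  have "{t \<in> S. \<not> P t} \<in> null_sets lebesgue"
    using negligible_finite[OF assms(1)] by (simp add: negligible_iff_null_sets)
  then have "AE t in lebesgue. t \<in> S \<longrightarrow> P t"
    by (rule AE_I') auto
  then show ?thesis using assms(2) by (simp add: AE_restrict_space_iff)
qed

section \<open>Level sets of the switching function\<close>

lemma continuous_on_matpow_vec:
  assumes "continuous_on S A" "continuous_on S b"
  shows "continuous_on S (\<lambda>\<alpha>. matpow (A \<alpha>) m *v b \<alpha>)"
proof (induction m)
  case 0
  show ?case using assms(2) by simp
next
  case (Suc m)
  show ?case
    using continuous_on_matrix_vector_mult[OF assms(1) Suc]
    by (simp add: matpow_Suc matrix_vector_mul_assoc)
qed

text \<open>
  The multiplier conditions hold only for almost every parameter, so everything takes place on a measurable set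
  \<open>E\<close> of full measure on which all of them hold; the moments \<open>a k\<close> are put to \<open>0\<close> outside.

  With \<open>\<beta> m = A\<^sup>m b \<bullet> G\<close>, where \<open>G\<close> is the gradient at the terminal state, the moments satisfy
  \<open>a m = - \<mu> * \<beta> m\<close>.  The multiplier \<open>\<mu>\<close> itself need not be measurable, since the moments do not
  see it where all \<open>\<beta> m\<close> vanish.  Hence the test field is built from the least squares solution
  \<open>r\<close> of these equations for \<open>m < d\<close>, which is measurable, nonnegative and yields the same
  moments up to sign.
\<close>

lemma switching_function_level_finite:
  fixes A :: "real^'k \<Rightarrow> real^'d^'d" and \<Lambda> :: "(real^'k) measure"
  assumes T: "T > 0" and \<A>: "compact \<A>"
    and A: "continuous_on \<A> A" and b: "continuous_on \<A> b"
    and \<psi>: "C1_on UNIV \<psi>" "convex_on UNIV \<psi>"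
    and u: "AE t in lebesgue_on {0..T}. u t \<in> {-1..1}"
    and x: "\<And>\<alpha>. \<alpha> \<in> \<A> \<Longrightarrow> state_solution T (A \<alpha>) (b \<alpha>) x0 u (x \<alpha>)"
    and pmp: "robust_pmp T \<A> A b \<psi> u x \<eta> \<Lambda> p"
    and ctr: "average_controllability T \<A> A b \<psi> x \<Lambda>"
    and y: "y \<noteq> 0"
  shows "finite {t \<in> {0..T}. switching_function b \<Lambda> p t = y}"
proof (rule ccontr)
  assume inf: "infinite {t \<in> {0..T}. switching_function b \<Lambda> p t = y}"
  define act where "act = active_set T \<A> \<psi> x"
  define G where "G \<alpha> = gradient \<psi> (x \<alpha> T)" for \<alpha>
  have sets_\<Lambda>: "sets \<Lambda> = sets (restrict_space borel \<A>)"
    and int: "\<And>t. t \<in> {0..T} \<Longrightarrow> integrable \<Lambda> (\<lambda>\<alpha>. p \<alpha> t \<bullet> b \<alpha>)"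
    and adj: "AE \<alpha> in \<Lambda>. adjoint_solution T (A \<alpha>) (p \<alpha>)"
    using pmp unfolding robust_pmp_def radon_measure_on_def by blast+
  obtain \<mu> where \<mu>: "AE \<alpha> in \<Lambda>. \<mu> \<alpha> \<ge> 0 \<and> - p \<alpha> T = \<mu> \<alpha> *\<^sub>R G \<alpha>"
    and supp: "measure_support \<Lambda> \<subseteq> act"
    using pmp unfolding robust_pmp_def G_def act_def by (elim conjE exE)
  have sp: "space \<Lambda> = \<A>" using sets_eq_imp_space_eq[OF sets_\<Lambda>] by (simp add: space_restrict_space)
  have borel: "f \<in> borel_measurable \<Lambda>" if "continuous_on \<A> f" for f :: "real^'k \<Rightarrow> 'c::topological_space"
    using borel_measurable_continuous_on_restrict[OF that] measurable_cong_sets[OF sets_\<Lambda> refl] by blast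
  have xT: "continuous_on \<A> (\<lambda>\<alpha>. x \<alpha> T)"
    using T by (intro terminal_state_continuous_on[OF \<A> A b u _ x]) auto
  have contG: "continuous_on \<A> G"
    unfolding G_def using continuous_on_compose2[OF C1_on_gradient(2)[OF \<psi>(1)] xT] by simp
  have "continuous_on \<A> (\<lambda>\<alpha>. \<psi> (x \<alpha> T))"
    using continuous_on_compose2[OF C1_on_imp_continuous_on[OF \<psi>(1) subset_UNIV] xT subset_UNIV] .
  then have "{\<alpha> \<in> space \<Lambda>. \<psi> (x \<alpha> T) = 0} \<in> sets \<Lambda>"
    by (intro borel_measurable_eq borel borel_measurable_const)
  then have act: "act \<in> sets \<Lambda>" by (simp add: act_def active_set_def sp)
  have act_Int: "act \<inter> space \<Lambda> \<in> sets \<Lambda>" using act by auto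
  have "AE \<alpha> in \<Lambda>. \<alpha> \<in> act \<and> adjoint_solution T (A \<alpha>) (p \<alpha>) \<and> \<mu> \<alpha> \<ge> 0 \<and> - p \<alpha> T = \<mu> \<alpha> *\<^sub>R G \<alpha>"
    using AE_in_measure_support[OF sets_\<Lambda>] adj \<mu> by eventually_elim (use supp in auto)
  then obtain N where N: "N \<in> null_sets \<Lambda>" and "{\<alpha> \<in> space \<Lambda>. \<not> (\<alpha> \<in> act \<and> adjoint_solution T (A \<alpha>) (p \<alpha>) \<and> \<mu> \<alpha> \<ge> 0 \<and> - p \<alpha> T = \<mu> \<alpha> *\<^sub>R G \<alpha>)} \<subseteq> N"
    unfolding eventually_ae_filter by (elim bexE)
  then have good: "\<alpha> \<in> act \<and> adjoint_solution T (A \<alpha>) (p \<alpha>) \<and> \<mu> \<alpha> \<ge> 0 \<and> - p \<alpha> T = \<mu> \<alpha> *\<^sub>R G \<alpha>"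
    if "\<alpha> \<in> space \<Lambda> - N" for \<alpha> using that by blast
  define E where "E = space \<Lambda> - N"
  have E: "E \<in> sets \<Lambda>" using N by (auto simp: E_def)
  have AE_E: "AE \<alpha> in \<Lambda>. \<alpha> \<in> E"
    by (rule AE_I'[OF N]) (auto simp: E_def)
  have E\<A>: "\<alpha> \<in> \<A>" if "\<alpha> \<in> E" for \<alpha> using that by (simp add: E_def sp)
  define a where "a k \<alpha> = (if \<alpha> \<in> E then p \<alpha> T \<bullet> (matpow (A \<alpha>) k *v b \<alpha>) else 0)" for k \<alpha>
  define F where "F s \<alpha> = indicator E \<alpha> *\<^sub>R (p \<alpha> (T - s) \<bullet> b \<alpha>)" for s \<alpha>
  obtain R where R: "R \<ge> 0" "\<And>\<alpha>. \<alpha> \<in> \<A> \<Longrightarrow> norm (A \<alpha>) \<le> R"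
    using compact_imp_bounded[OF compact_continuous_image[OF A \<A>]] by (auto simp: bounded_pos intro: less_imp_le)
  have AR: "norm (A \<alpha> *v z) \<le> R * norm z" if "\<alpha> \<in> E" for \<alpha> z
    using norm_matrix_vector_mult_le R(2)[OF E\<A>[OF that]] by (meson mult_right_mono norm_ge_zero order_trans)
  interpret exponential_coefficients \<Lambda> a F "2 * R + 1" T "CARD('d)"
  proof
    show "\<bar>a k \<alpha>\<bar> \<le> (2 * R + 1) ^ k * (\<Sum>j<CARD('d). \<bar>a j \<alpha>\<bar>)" for k \<alpha>
      using krylov_moment_growth[OF AR R(1), of \<alpha> "p \<alpha> T" k "b \<alpha>"] by (simp add: a_def)
    show "(\<lambda>k. a k \<alpha> / fact k * s ^ k) sums F s \<alpha>" if "s \<in> {0..T}" for s \<alpha>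
    proof (cases "\<alpha> \<in> E")
      case True
      then show ?thesis
        using adjoint_taylor_series[OF _ AR[OF True] R(1) that, of "p \<alpha>" "b \<alpha>"] good[of \<alpha>]
        by (simp add: a_def F_def E_def)
    next
      case False
      then show ?thesis by (simp add: a_def F_def)
    qed
    show "integrable \<Lambda> (F s)" if "s \<in> {0..T}" for s
      unfolding F_def using that by (intro integrable_mult_indicator E int) auto
  qed (use R T in auto)
  define c where "c k = (LINT \<alpha>|\<Lambda>. a k \<alpha>)" for k
  have F_switching: "(LINT \<alpha>|\<Lambda>. F s \<alpha>) = switching_function b \<Lambda> p (T - s)" if "s \<in> {0..T}" for s
    unfolding switching_function_def
  proof (rule integral_cong_AE)
    show "F s \<in> borel_measurable \<Lambda>" using integrable_F[OF that] by simp
    show "(\<lambda>\<alpha>. p \<alpha> (T - s) \<bullet> b \<alpha>) \<in> borel_measurable \<Lambda>"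
      using int[of "T - s"] that by (intro borel_measurable_integrable) auto
    show "AE \<alpha> in \<Lambda>. F s \<alpha> = p \<alpha> (T - s) \<bullet> b \<alpha>"
      using AE_E by eventually_elim (simp add: F_def)
  qed
  have "{t \<in> {0..T}. switching_function b \<Lambda> p t = y}
      \<subseteq> (\<lambda>s. T - s) ` {s \<in> {0..T}. switching_function b \<Lambda> p (T - s) = y}"
  proof
    fix t assume "t \<in> {t \<in> {0..T}. switching_function b \<Lambda> p t = y}"
    then show "t \<in> (\<lambda>s. T - s) ` {s \<in> {0..T}. switching_function b \<Lambda> p (T - s) = y}"
      by (intro image_eqI[of _ _ "T - t"]) auto
  qed
  with inf have inf': "infinite {s \<in> {0..T}. switching_function b \<Lambda> p (T - s) = y}"
    using finite_subset by blast
  have c: "c 0 = y \<and> (\<forall>k>0. c k = 0)"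
  proof (rule entire_series_constant_of_infinite_level_set[OF _ _ inf'])
    show "\<bar>c k\<bar> \<le> (2 * R + 1) ^ k * (\<Sum>j<CARD('d). LINT \<alpha>|\<Lambda>. \<bar>a j \<alpha>\<bar>)" for k
      unfolding c_def by (rule order_trans[OF integral_abs_bound integral_growth])
    show "(\<lambda>k. c k / fact k * s ^ k) sums switching_function b \<Lambda> p (T - s)" if "s \<in> {0..T}" for s
      using integral_series[OF that] F_switching[OF that] by (simp add: c_def)
  qed
  define \<beta> where "\<beta> m \<alpha> = (matpow (A \<alpha>) m *v b \<alpha>) \<bullet> G \<alpha>" for m \<alpha>
  have meas_\<beta>: "\<beta> m \<in> borel_measurable \<Lambda>" for m
    unfolding \<beta>_def by (intro borel continuous_intros continuous_on_matpow_vec A b contG)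
  \<comment> \<open>Where all \<open>\<beta> m\<close> with \<open>m < d\<close> vanish, the quotient is \<open>0\<close> because division by zero gives zero.\<close>
  define r where "r \<alpha> = - (\<Sum>m<CARD('d). a m \<alpha> * \<beta> m \<alpha>) / (\<Sum>m<CARD('d). (\<beta> m \<alpha>)\<^sup>2)" for \<alpha>
  define v where "v \<alpha> = r \<alpha> *\<^sub>R G \<alpha>" for \<alpha>
  have a\<beta>: "a m \<alpha> = - \<mu> \<alpha> * \<beta> m \<alpha>" if "\<alpha> \<in> E" for m \<alpha>
  proof -
    have "p \<alpha> T = - (\<mu> \<alpha> *\<^sub>R G \<alpha>)" using good[of \<alpha>] that by (metis E_def minus_minus)
    then show ?thesis using that by (simp add: a_def \<beta>_def inner_commute)
  qed
  have r_E: "r \<alpha> = (if (\<Sum>m<CARD('d). (\<beta> m \<alpha>)\<^sup>2) = 0 then 0 else \<mu> \<alpha>)" if "\<alpha> \<in> E" for \<alpha>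
  proof -
    have "- (\<Sum>m<CARD('d). a m \<alpha> * \<beta> m \<alpha>) = \<mu> \<alpha> * (\<Sum>m<CARD('d). (\<beta> m \<alpha>)\<^sup>2)"
      by (simp add: a\<beta>[OF that] sum_negf sum_distrib_left power2_eq_square mult.assoc)
    then show ?thesis by (simp add: r_def)
  qed
  have r_nonneg: "r \<alpha> \<ge> 0" for \<alpha>
  proof (cases "\<alpha> \<in> E")
    case True
    then show ?thesis using r_E[OF True] good[of \<alpha>] by (simp add: E_def)
  next
    case False
    then show ?thesis by (simp add: r_def a_def)
  qed
  have v_moment: "(matpow (A \<alpha>) m *v b \<alpha>) \<bullet> v \<alpha> = - a m \<alpha>" if m: "m < CARD('d)" for m \<alpha>
  proof (cases "\<alpha> \<in> E")
    case True
    have "\<beta> m \<alpha> = 0" if "(\<Sum>m<CARD('d). (\<beta> m \<alpha>)\<^sup>2) = 0"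
      using that m by (subst (asm) sum_nonneg_eq_0_iff) auto
    then have "r \<alpha> * \<beta> m \<alpha> = - a m \<alpha>" using r_E[OF True] a\<beta>[OF True, of m] by auto
    then show ?thesis by (simp add: v_def \<beta>_def)
  next
    case False
    then show ?thesis by (simp add: v_def r_def a_def)
  qed
  define \<Lambda>act where "\<Lambda>act = restrict_space \<Lambda> act"
  \<comment> \<open>The moments vanish outside \<open>E\<close>, which lies in the active set, so restricting to the latter loses nothing.\<close>
  have act_a: "indicator act \<alpha> *\<^sub>R (- a m \<alpha>) = - a m \<alpha>" for m \<alpha>
    using good[of \<alpha>] by (auto simp: a_def E_def indicator_def)
  have v_meas: "v \<in> borel_measurable \<Lambda>act"
    unfolding \<Lambda>act_def v_def r_def
    by (intro measurable_restrict_space1 borel_measurable_scaleR borel_measurable_divide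
        borel_measurable_uminus borel_measurable_sum borel_measurable_times borel_measurable_power
        measurable_coefficient meas_\<beta> borel contG)
  have v_normal: "\<forall>\<alpha>\<in>act. v \<alpha> \<in> normal_cone (terminal_set \<psi>) (x \<alpha> T)"
    using gradient_in_normal_cone[OF \<psi>] r_nonneg by (simp add: v_def G_def act_def active_set_def)
  have int_v: "integrable \<Lambda>act (\<lambda>\<alpha>. (matpow (A \<alpha>) m *v b \<alpha>) \<bullet> v \<alpha>)"
    and zero_v: "(LINT \<alpha>|\<Lambda>act. (matpow (A \<alpha>) m *v b \<alpha>) \<bullet> v \<alpha>) = 0" if "m \<in> {1..CARD('d) - 1}" for m
  proof -
    have m: "m < CARD('d)" "m > 0" using that by auto
    show "integrable \<Lambda>act (\<lambda>\<alpha>. (matpow (A \<alpha>) m *v b \<alpha>) \<bullet> v \<alpha>)"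
      unfolding \<Lambda>act_def v_moment[OF m(1)] integrable_restrict_space[OF act_Int] act_a
      using integrable_coefficient[of m] by simp
    show "(LINT \<alpha>|\<Lambda>act. (matpow (A \<alpha>) m *v b \<alpha>) \<bullet> v \<alpha>) = 0"
      unfolding \<Lambda>act_def v_moment[OF m(1)] integral_restrict_space[OF act_Int] act_a
      using c m(2) by (simp add: c_def)
  qed
  \<comment> \<open>All the integrals in the controllability condition vanish for \<open>v\<close>.\<close>
  have "AE \<alpha> in \<Lambda>act. v \<alpha> = 0"
    using ctr v_meas v_normal int_v zero_v
    unfolding average_controllability_def Let_def act_def[symmetric] \<Lambda>act_def[symmetric] by blast
  then have "AE \<alpha> in \<Lambda>. \<alpha> \<in> act \<longrightarrow> v \<alpha> = 0"
    unfolding \<Lambda>act_def AE_restrict_space_iff[OF act_Int] .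
  then have "AE \<alpha> in \<Lambda>. a 0 \<alpha> = 0"
  proof eventually_elim
    case (elim \<alpha>)
    have "a 0 \<alpha> = - ((matpow (A \<alpha>) 0 *v b \<alpha>) \<bullet> v \<alpha>)" by (subst v_moment) auto
    moreover have "a 0 \<alpha> = 0" if "\<alpha> \<notin> act" using that good[of \<alpha>] by (auto simp: a_def E_def)
    ultimately show ?case using elim by auto
  qed
  then have "c 0 = 0" unfolding c_def by (rule integral_eq_zero_AE)
  with c y show False by simp
qed

theorem corollary3p4:
  fixes T :: real
    and \<A> :: "(real^'k) set"
    and A :: "real^'k \<Rightarrow> real^'d^'d"
    and b :: "real^'k \<Rightarrow> real^'d"
    and x0 :: "real^'d"
    and \<psi> :: "real^'d \<Rightarrow> real"
    and u :: "real \<Rightarrow> real"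
    and x :: "real^'k \<Rightarrow> real \<Rightarrow> real^'d"
    and \<eta> :: real
    and \<Lambda> :: "(real^'k) measure"
    and p :: "real^'k \<Rightarrow> real \<Rightarrow> real^'d"
  defines "\<phi> \<equiv> switching_function b \<Lambda> p"
  assumes T: "T > 0"
    and \<A>: "\<A> \<noteq> {}" "compact \<A>" "convex \<A>"
    and A_b_C1: "\<exists>W. open W \<and> \<A> \<subseteq> W \<and> C1_on W A \<and> C1_on W b"
    and \<psi>: "C1_on UNIV \<psi>" "convex_on UNIV \<psi>"
    and C: "compact (terminal_set \<psi>)" "convex (terminal_set \<psi>)"
    and U_nonempty: "admissible_controls T \<A> A b x0 \<psi> \<noteq> {}"
    and optimal: "optimal_process T \<A> A b x0 \<psi> u x"
    and multipliers: "robust_pmp T \<A> A b \<psi> u x \<eta> \<Lambda> p"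
    and normality: "\<eta> > 0"
    and controllability: "average_controllability T \<A> A b \<psi> x \<Lambda>"
  shows "AE t in lebesgue_on {0..T}.
           (\<phi> t > \<eta> \<and> \<not> \<bar>\<phi> t\<bar> < \<eta> \<and> \<not> \<phi> t < - \<eta> \<and> u t = 1) \<or>
           (\<not> \<phi> t > \<eta> \<and> \<bar>\<phi> t\<bar> < \<eta> \<and> \<not> \<phi> t < - \<eta> \<and> u t = 0) \<or>
           (\<not> \<phi> t > \<eta> \<and> \<not> \<bar>\<phi> t\<bar> < \<eta> \<and> \<phi> t < - \<eta> \<and> u t = -1)"
proof -
  obtain W where W: "\<A> \<subseteq> W" "C1_on W A" "C1_on W b" using A_b_C1 by blast
  have u: "AE t in lebesgue_on {0..T}. u t \<in> {-1..1}"
    and x: "\<And>\<alpha>. \<alpha> \<in> \<A> \<Longrightarrow> state_solution T (A \<alpha>) (b \<alpha>) x0 u (x \<alpha>)"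
    using optimal unfolding optimal_process_def admissible_controls_def by blast+
  have level: "finite {t \<in> {0..T}. \<phi> t = y}" if "y \<noteq> 0" for y
    unfolding \<phi>_def
    by (rule switching_function_level_finite[OF T \<A>(2) C1_on_imp_continuous_on[OF W(2,1)]
        C1_on_imp_continuous_on[OF W(3,1)] \<psi> u x multipliers controllability that])
  have "finite ({t \<in> {0..T}. \<phi> t = \<eta>} \<union> {t \<in> {0..T}. \<phi> t = - \<eta>})"
    using level[of \<eta>] level[of "- \<eta>"] normality by simp
  moreover have "{t \<in> {0..T}. \<not> (\<phi> t \<noteq> \<eta> \<and> \<phi> t \<noteq> - \<eta>)}
      = {t \<in> {0..T}. \<phi> t = \<eta>} \<union> {t \<in> {0..T}. \<phi> t = - \<eta>}" by auto
  ultimately have "AE t in lebesgue_on {0..T}. \<phi> t \<noteq> \<eta> \<and> \<phi> t \<noteq> - \<eta>"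
    by (intro finite_exceptional_times_AE) auto
  moreover have "AE t in lebesgue_on {0..T}.
      is_arg_max (\<lambda>v. \<phi> t * v - \<eta> * \<bar>v\<bar>) (\<lambda>v. v \<in> {-1..1}) (u t)"
    using multipliers unfolding robust_pmp_def \<phi>_def by blast
  ultimately show ?thesis
    by eventually_elim (use arg_max_bang_off_bang normality in blast)
qed

end
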